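(* Let $\hat{\mathcal L}$ be the $N=2$ superconformal Neveu-Schwarz algebra, with bracket $[\cdot,\cdot]$. Every Lie superbialgebra structure on $\hat{\mathcal L}$ is triangular coboundary; that is, for every linear map $\Delta:\hat{\mathcal L}\to\hat{\mathcal L}\otimes\hat{\mathcal L}$ such that $(\hat{\mathcal L},[\cdot,\cdot],\Delta)$ is a Lie superbialgebra, there exists $r\in\mathrm{Im}(1-\tau)\subset\hat{\mathcal L}\otimes\hat{\mathcal L}$ such that $\Delta=\Delta_r$ and $c(r)=0$.
   Context: All vector spaces are over $\mathbb C$. $\hat{\mathcal L}$ is the Lie superalgebra with basis $\{L_m, I_m, G_p^{\pm}, C \mid m\in\mathbb Z,\ p\in\mathbb Z+\tfrac12\}$, where $C$ is central, the elements $L_m,I_m,C$ are even, the elements $G_p^\pm$ are odd, and for $m,n\in\mathbb Z$, $p,q\in\mathbb Z+\frac12$: $[L_m,L_n]=(m-n)L_{m+n}+\frac1{12}(m^3-m)\delta_{m+n,0}C$, $[I_m,I_n]=\frac13 m\delta_{m+n,0}C$, $[L_m,I_n]=-nI_{m+n}$, $[L_m,G_p^\pm]=(\frac m2-p)G_{p+m}^\pm$, $[I_m,G_p^\pm]=\pm G_{m+p}^\pm$, $[G_p^+,G_q^-]=2L_{p+q}+(p-q)I_{p+q}+\frac13(p^2-\frac14)\delta_{p+q,0}C$, $[G_p^\pm,G_q^\pm]=0$. Let $L=L_{\bar0}\oplus L_{\bar1}$ be a Lie superalgebra; $[x]\in\mathbb Z_2$ denotes the parity of a homogeneous element $x$.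 Whenever a parity appears in a formula the element is taken homogeneous, and formulas are extended linearly. The super-twist map is $\tau(x\otimes y)=(-1)^{[x][y]}y\otimes x$ on $L\otimes L$; the super-cyclic map on $L^{\otimes3}$ is $\xi(x_1\otimes x_2\otimes x_3)=(-1)^{[x_1]([x_2]+[x_3])}x_2\otimes x_3\otimes x_1$; $1$ denotes an identity map. The adjoint diagonal action of $L$ on $L\otimes L$ is $x*\sum_i a_i\otimes b_i=\sum_i([x,a_i]\otimes b_i+(-1)^{[x][a_i]}a_i\otimes[x,b_i])$. A Lie superbialgebra $(L,[\cdot,\cdot],\Delta)$ is a Lie superalgebra $(L,[\cdot,\cdot])$ with a linear map $\Delta:L\to L\otimes L$ such that (i) $\Delta(L_{\bar i})\subset\sum_{\bar j\in\mathbb Z_2}L_{\bar j}\otimes L_{\bar i-\bar j}$; (ii) $\mathrm{Im}\,\Delta\subset\mathrm{Im}(1-\tau)$; (iii) $(1+\xi+\xi^2)\cdot(1\otimes\Delta)\cdot\Delta=0$; (iv) $\Delta([x,y])=x*\Delta y-(-1)^{[x][y]}y*\Delta x$ for all $x,y\in L$. For $r\in L\otimes L$, $\Delta_r(x)=(-1)^{[r][x]}x*r$ for $x\in L$. For $r=\sum_i a_i\otimes b_i$, $c(r)=[r^{12},r^{13}]+[r^{12},r^{23}]+[r^{13},r^{23}]\in L^{\otimes 3}$, where $[r^{12},r^{13}]=\sum_{i,j}(-1)^{[a_j][b_i]}[a_i,a_j]\otimes b_i\otimes b_j$, $[r^{12},r^{23}]=\sum_{i,j}a_i\otimes[b_i,a_j]\otimes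 b_j$, $[r^{13},r^{23}]=\sum_{i,j}(-1)^{[a_j][b_i]}a_i\otimes a_j\otimes[b_i,b_j]$. The Lie superbialgebra is coboundary if $\Delta=\Delta_r$ for some $r\in\mathrm{Im}(1-\tau)$, and triangular coboundary if moreover $c(r)=0$ (classical Yang-Baxter equation). *)

theory Defs
  imports Complex_Main "HOL-Library.Poly_Mapping" "HOL-Library.Z2"
begin

text \<open>
  A complex vector superspace is presented by a homogeneous basis: it is the space of finitely
  supported functions on a type of basis vectors, together with a parity function
  \<open>par\<close> on that type with values in the two-element field \<open>bit\<close>.  The tensor
  product of two such spaces is the free space on the product type, and a triple tensor product is
  nested to the right.
\<close>

type_synonym 'b cvec = "'b \<Rightarrow>\<^sub>0 complex"

definition smul :: "complex \<Rightarrow> 'b cvec \<Rightarrow> 'b cvec"  (infixr \<open>\<cdot>\<close> 75)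
  where "c \<cdot> x = Poly_Mapping.map ((*) c) x"

abbreviation bvec :: "'b \<Rightarrow> 'b cvec"
  where "bvec b \<equiv> Poly_Mapping.single b 1"

abbreviation clinear :: "('a cvec \<Rightarrow> 'b cvec) \<Rightarrow> bool"
  where "clinear \<equiv> Vector_Spaces.linear smul smul"

lemma lookup_smul [simp]: "Poly_Mapping.lookup (c \<cdot> x) b = c * Poly_Mapping.lookup x b"
  unfolding smul_def by (simp add: Poly_Mapping.map.rep_eq when_def)

global_interpretation cvec: vector_space "smul :: complex \<Rightarrow> 'b cvec \<Rightarrow> 'b cvec"
  by unfold_locales (auto intro!: poly_mapping_eqI simp: lookup_add algebra_simps)

definition lin_ext :: "('a \<Rightarrow> 'b cvec) \<Rightarrow> 'a cvec \<Rightarrow> 'b cvec" where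
  "lin_ext f x = (\<Sum>a\<in>Poly_Mapping.keys x. Poly_Mapping.lookup x a \<cdot> f a)"

definition bilin_ext :: "('a \<Rightarrow> 'b \<Rightarrow> 'c cvec) \<Rightarrow> 'a cvec \<Rightarrow> 'b cvec \<Rightarrow> 'c cvec" where
  "bilin_ext f x y = lin_ext (\<lambda>a. lin_ext (f a) y) x"

definition tensor :: "'a cvec \<Rightarrow> 'b cvec \<Rightarrow> ('a \<times> 'b) cvec"  (infixr \<open>\<otimes>\<close> 76) where
  "x \<otimes> y = bilin_ext (\<lambda>a b. bvec (a, b)) x y"

text \<open>\<open>ksign i\<close> is $(-1)^i$, and \<open>homog par i\<close> is the space of vectors of parity \<open>i\<close>.\<close>

definition ksign :: "bit \<Rightarrow> complex" where
  "ksign i = (if i = 0 then 1 else - 1)"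

definition homog :: "('b \<Rightarrow> bit) \<Rightarrow> bit \<Rightarrow> 'b cvec set" where
  "homog par i = {x. \<forall>b\<in>Poly_Mapping.keys x. par b = i}"

locale lie_superalgebra =
  fixes par :: "'b \<Rightarrow> bit"
    and br :: "'b cvec \<Rightarrow> 'b cvec \<Rightarrow> 'b cvec"
  assumes linear_left: "clinear (\<lambda>x. br x y)"
    and linear_right: "clinear (br x)"
    and graded: "x \<in> homog par i \<Longrightarrow> y \<in> homog par j \<Longrightarrow> br x y \<in> homog par (i + j)"
    and super_skew: "x \<in> homog par i \<Longrightarrow> y \<in> homog par j \<Longrightarrow>
      br x y = - (ksign (i * j) \<cdot> br y x)"
    and super_jacobi: "x \<in> homog par i \<Longrightarrow> y \<in> homog par j \<Longrightarrow> z \<in> homog par k \<Longrightarrow>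
      br x (br y z) = br (br x y) z + ksign (i * j) \<cdot> br y (br x z)"

definition super_twist :: "('b \<Rightarrow> bit) \<Rightarrow> ('b \<times> 'b) cvec \<Rightarrow> ('b \<times> 'b) cvec" where
  "super_twist par = lin_ext (\<lambda>(a, b). ksign (par a * par b) \<cdot> bvec (b, a))"

definition super_cyclic :: "('b \<Rightarrow> bit) \<Rightarrow> ('b \<times> 'b \<times> 'b) cvec \<Rightarrow> ('b \<times> 'b \<times> 'b) cvec" where
  "super_cyclic par =
    lin_ext (\<lambda>(a, b, c). ksign (par a * (par b + par c)) \<cdot> bvec (b, c, a))"

definition im_one_minus_twist :: "('b \<Rightarrow> bit) \<Rightarrow> ('b \<times> 'b) cvec set" where
  "im_one_minus_twist par = range (\<lambda>t. t - super_twist par t)"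

definition adj_act ::
  "('b \<Rightarrow> bit) \<Rightarrow> ('b cvec \<Rightarrow> 'b cvec \<Rightarrow> 'b cvec) \<Rightarrow> 'b cvec \<Rightarrow> ('b \<times> 'b) cvec \<Rightarrow> ('b \<times> 'b) cvec"
  where
  "adj_act par br = bilin_ext (\<lambda>x (a, b).
      br (bvec x) (bvec a) \<otimes> bvec b
    + ksign (par x * par a) \<cdot> (bvec a \<otimes> br (bvec x) (bvec b)))"

text \<open>The map $1 \otimes \Delta$; no sign occurs because $1$ and $\Delta$ are even.\<close>

definition id_tensor :: "('b cvec \<Rightarrow> ('b \<times> 'b) cvec) \<Rightarrow> ('b \<times> 'b) cvec \<Rightarrow> ('b \<times> 'b \<times> 'b) cvec" where
  "id_tensor \<Delta> = lin_ext (\<lambda>(a, b). bvec a \<otimes> \<Delta> (bvec b))"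

locale lie_superbialgebra = lie_superalgebra par br
  for par :: "'b \<Rightarrow> bit" and br :: "'b cvec \<Rightarrow> 'b cvec \<Rightarrow> 'b cvec" +
  fixes \<Delta> :: "'b cvec \<Rightarrow> ('b \<times> 'b) cvec"
  assumes cobracket_linear: "clinear \<Delta>"
    and cobracket_graded:
      "\<Delta> ` homog par i \<subseteq> cvec.span (\<Union>j. {x \<otimes> y |x y. x \<in> homog par j \<and> y \<in> homog par (i - j)})"
    and cobracket_skew: "range \<Delta> \<subseteq> im_one_minus_twist par"
    and co_jacobi: "id_tensor \<Delta> (\<Delta> x) + super_cyclic par (id_tensor \<Delta> (\<Delta> x))
      + super_cyclic par (super_cyclic par (id_tensor \<Delta> (\<Delta> x))) = 0"
    and cocycle: "x \<in> homog par i \<Longrightarrow> y \<in> homog par j \<Longrightarrow>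
      \<Delta> (br x y) = adj_act par br x (\<Delta> y) - ksign (i * j) \<cdot> adj_act par br y (\<Delta> x)"

text \<open>
  $\Delta_r(x) = (-1)^{[r][x]}\, x * r$ for homogeneous $r$ and $x$, extended bilinearly in
  $(x, r)$; the vector $a \otimes b$ has parity $[a] + [b]$.
\<close>

definition coboundary ::
  "('b \<Rightarrow> bit) \<Rightarrow> ('b cvec \<Rightarrow> 'b cvec \<Rightarrow> 'b cvec) \<Rightarrow> ('b \<times> 'b) cvec \<Rightarrow> 'b cvec \<Rightarrow> ('b \<times> 'b) cvec"
  where
  "coboundary par br r x = bilin_ext (\<lambda>x (a, b).
     ksign ((par a + par b) * par x) \<cdot> adj_act par br (bvec x) (bvec (a, b))) x r"

text \<open>
  The classical Yang-Baxter element $c(r)$.  The three summands are $[r^{12},r^{13}]$,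
  $[r^{12},r^{23}]$ and $[r^{13},r^{23}]$; the pairs \<open>(a, b)\<close> and \<open>(a', b')\<close> stand for
  $a_i \otimes b_i$ and $a_j \otimes b_j$.
\<close>

definition cybe ::
  "('b \<Rightarrow> bit) \<Rightarrow> ('b cvec \<Rightarrow> 'b cvec \<Rightarrow> 'b cvec) \<Rightarrow> ('b \<times> 'b) cvec \<Rightarrow> ('b \<times> 'b \<times> 'b) cvec"
  where
  "cybe par br r = bilin_ext (\<lambda>(a, b) (a', b').
       ksign (par a' * par b) \<cdot> (br (bvec a) (bvec a') \<otimes> bvec b \<otimes> bvec b')
     + bvec a \<otimes> br (bvec b) (bvec a') \<otimes> bvec b'
     + ksign (par a' * par b) \<cdot> (bvec a \<otimes> bvec a' \<otimes> br (bvec b) (bvec b'))) r r"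

text \<open>
  The $N=2$ superconformal Neveu-Schwarz algebra.  The odd generators have half-integral modes:
  \<open>GP k\<close> and \<open>GM k\<close> stand for $G^+_p$ and $G^-_p$ with $p = k + \frac12$.
\<close>

datatype ns2_basis = LL int | II int | GP int | GM int | CC

fun ns2_par :: "ns2_basis \<Rightarrow> bit" where
  "ns2_par (GP k) = 1"
| "ns2_par (GM k) = 1"
| "ns2_par _ = 0"

definition half_mode :: "int \<Rightarrow> complex" where
  "half_mode k = of_int k + 1 / 2"

text \<open>
  \<open>ns2_GG j k\<close> is $[G^+_p, G^-_q]$ for $p = j + \frac12$ and $q = k + \frac12$, so that
  $p + q = j + k + 1$.
\<close>

definition ns2_GG :: "int \<Rightarrow> int \<Rightarrow> ns2_basis cvec" where
  "ns2_GG j k = 2 \<cdot> bvec (LL (j + k + 1))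
    + (half_mode j - half_mode k) \<cdot> bvec (II (j + k + 1))
    + (if j + k + 1 = 0 then ((half_mode j)\<^sup>2 - 1 / 4) / 3 else 0) \<cdot> bvec CC"

fun ns2_br_basis :: "ns2_basis \<Rightarrow> ns2_basis \<Rightarrow> ns2_basis cvec" where
  "ns2_br_basis (LL m) (LL n) = of_int (m - n) \<cdot> bvec (LL (m + n))
     + (if m + n = 0 then of_int (m ^ 3 - m) / 12 else 0) \<cdot> bvec CC"
| "ns2_br_basis (II m) (II n) = (if m + n = 0 then of_int m / 3 else 0) \<cdot> bvec CC"
| "ns2_br_basis (LL m) (II n) = (- of_int n) \<cdot> bvec (II (m + n))"
| "ns2_br_basis (II n) (LL m) = of_int n \<cdot> bvec (II (m + n))"
| "ns2_br_basis (LL m) (GP k) = (of_int m / 2 - half_mode k) \<cdot> bvec (GP (k + m))"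
| "ns2_br_basis (GP k) (LL m) = (half_mode k - of_int m / 2) \<cdot> bvec (GP (k + m))"
| "ns2_br_basis (LL m) (GM k) = (of_int m / 2 - half_mode k) \<cdot> bvec (GM (k + m))"
| "ns2_br_basis (GM k) (LL m) = (half_mode k - of_int m / 2) \<cdot> bvec (GM (k + m))"
| "ns2_br_basis (II m) (GP k) = bvec (GP (m + k))"
| "ns2_br_basis (GP k) (II m) = - bvec (GP (m + k))"
| "ns2_br_basis (II m) (GM k) = - bvec (GM (m + k))"
| "ns2_br_basis (GM k) (II m) = bvec (GM (m + k))"
| "ns2_br_basis (GP j) (GM k) = ns2_GG j k"
| "ns2_br_basis (GM k) (GP j) = ns2_GG j k"
| "ns2_br_basis (GP j) (GP k) = 0"
| "ns2_br_basis (GM j) (GM k) = 0"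
| "ns2_br_basis CC _ = 0"
| "ns2_br_basis _ CC = 0"

definition ns2_br :: "ns2_basis cvec \<Rightarrow> ns2_basis cvec \<Rightarrow> ns2_basis cvec" where
  "ns2_br = bilin_ext ns2_br_basis"

end

theory Submission
  imports Defs
begin

text \<open>
  A cobracket $\Delta$ is an even 1-cocycle of the algebra $L$ with values in the tensors that are skew for
  the super-twist.  The theorem therefore has two parts: such a cocycle is inner, that is
  $\Delta(x) = x * r$ with $r$ even and skew, and the Yang-Baxter element $c(r)$ of a potential vanishes.

  \<^bold>\<open>The cocycle is inner\<close> (\<open>skew_cocycle_inner\<close>).  The odd elements $G^+_p$ (in the code \<open>GP k\<close>, with
  $p = k + \frac12$) anticommute and square to zero, so each acts on $L \otimes L$ as a differential.
  For $p = \pm\frac12$ these differentials have no central terms, and the basis vectors other than $C$ span a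
  free module over the Grassmann algebra of the two, with basis the $G^-_q$.  Explicit homotopies then
  provide a potential for the values of $\Delta$ on both (\<open>potential_GP_half\<close>); subtract it.

  Modulo tensors with a central leg, an odd skew tensor killed by three consecutive $G^+_p$ is described by
  one antisymmetric Laurent polynomial $h(x, y)$ (\<open>odd_structure\<close>).  Antisymmetry makes $h$ divisible by
  $x - y$, and the quotient is what is needed to correct $\Delta$ on a third element
  (\<open>potential_GP_three_halves\<close>).  A fourth differential imposes $(x - y)^3 h = 0$, so no further
  freedom is left and $\Delta$ is central on all $G^+_p$ (\<open>odd_rigid\<close>, \<open>odd_generators_central\<close>).  Tensors
  have finite support, so letting $p \to \infty$ shows that an even tensor killed by all $G^+_p$ has, up to central
  terms, only components in $G^+ \otimes G^+$ (\<open>even_structure\<close>); there $I_0$ acts as $2$ and removes the rest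
  (\<open>potential_I0\<close>, \<open>all_central\<close>).  What remains has the form $x \mapsto C \otimes d(x) - d(x) \otimes C$ with a
  derivation $d$ into $L / \langle C \rangle$, which is zero on a generating set (\<open>zero_if_all_central\<close>).

  \<^bold>\<open>The Yang-Baxter equation.\<close>  For an even skew $r$, the co-Jacobi expression of $\Delta_r$ at $x$ equals
  $x * c(r)$ (\<open>co_jacobi_cybe\<close>), so $c(r)$ is an invariant of $L^{\otimes 3}$.  Acting with modes of large index
  on one leg after the other shows that the finitely supported invariants are the multiples of
  $C \otimes C \otimes C$ (\<open>triple_invariant\<close>), and that coefficient of $c(r)$ is zero (\<open>coord_cybe_CC\<close>).
\<close>

section \<open>Linear algebra of free vector spaces\<close>

lemma cvec_eq_sum: "x = (\<Sum>a\<in>Poly_Mapping.keys x. Poly_Mapping.lookup x a \<cdot> bvec a)"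
  by (rule poly_mapping_eqI)
    (simp add: lookup_sum lookup_single when_def in_keys_iff if_distrib cong: if_cong)

text \<open>
  Linear statements are proved by this induction; the basis case comes with a scalar so that both
  linearity rules fire in the simplifier.
\<close>

lemma cvec_induct [case_names zero add basis]:
  assumes "P 0" and "\<And>x y. P x \<Longrightarrow> P y \<Longrightarrow> P (x + y)" and "\<And>c a. P (c \<cdot> bvec a)"
  shows "P (x :: 'a cvec)"
proof -
  have "P (\<Sum>a\<in>S. Poly_Mapping.lookup x a \<cdot> bvec a)" for S
    by (induction S rule: infinite_finite_induct) (auto intro: assms)
  then show ?thesis by (subst cvec_eq_sum)
qed

lemma homog_induct [consumes 1, case_names zero add basis]:
  assumes "x \<in> homog par i"
    and "P 0" and "\<And>x y. P x \<Longrightarrow> P y \<Longrightarrow> P (x + y)" and "\<And>c a. par a = i \<Longrightarrow> P (c \<cdot> bvec a)"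
  shows "P x"
proof -
  have "S \<subseteq> Poly_Mapping.keys x \<Longrightarrow> P (\<Sum>a\<in>S. Poly_Mapping.lookup x a \<cdot> bvec a)" for S
  proof (induction S rule: infinite_finite_induct)
    case (insert a S)
    then have "par a = i" using assms(1) by (auto simp: homog_def)
    with insert show ?case by (auto intro!: assms(3,4))
  qed (use assms in auto)
  then show ?thesis by (subst cvec_eq_sum) auto
qed

lemma homog_iff_lookup: "x \<in> homog par i \<longleftrightarrow> (\<forall>a. Poly_Mapping.lookup x a \<noteq> 0 \<longrightarrow> par a = i)"
  by (auto simp: homog_def in_keys_iff)

lemma bvec_homog [simp]: "bvec a \<in> homog par i \<longleftrightarrow> par a = i"
  by (simp add: homog_def)

lemma basis_homog: "bvec a \<in> homog par (par a)"
  by simp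

lemma lin_ext_eq_sum:
  assumes "finite S" "Poly_Mapping.keys x \<subseteq> S"
  shows "lin_ext f x = (\<Sum>a\<in>S. Poly_Mapping.lookup x a \<cdot> f a)"
  unfolding lin_ext_def
  by (rule sum.mono_neutral_left) (use assms in \<open>auto simp: in_keys_iff\<close>)

lemma lin_ext_zero [simp]: "lin_ext f 0 = 0"
  by (simp add: lin_ext_def)

lemma lin_ext_add: "lin_ext f (x + y) = lin_ext f x + lin_ext f y"
proof -
  let ?S = "Poly_Mapping.keys x \<union> Poly_Mapping.keys y"
  have "Poly_Mapping.keys (x + y) \<subseteq> ?S" by (rule keys_add)
  then show ?thesis
    by (simp add: lin_ext_eq_sum[of ?S] lookup_add cvec.scale_left_distrib sum.distrib)
qed

lemma lin_ext_smul: "lin_ext f (c \<cdot> x) = c \<cdot> lin_ext f x"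
proof -
  have "Poly_Mapping.keys (c \<cdot> x) \<subseteq> Poly_Mapping.keys x"
    by (auto simp: in_keys_iff)
  then show ?thesis
    by (simp add: lin_ext_eq_sum[of "Poly_Mapping.keys x"] cvec.scale_sum_right)
qed

lemma lin_ext_bvec [simp]: "lin_ext f (bvec a) = f a"
  by (simp add: lin_ext_def)

lemma lin_ext_plus_fun: "lin_ext (\<lambda>a. f a + h a) x = lin_ext f x + lin_ext h x"
  by (simp add: lin_ext_def cvec.scale_right_distrib sum.distrib)

lemma lin_ext_smul_fun: "lin_ext (\<lambda>a. c \<cdot> f a) x = c \<cdot> lin_ext f x"
  by (simp add: lin_ext_def cvec.scale_sum_right mult.commute)

lemma lookup_lin_ext:
  assumes "finite S" "\<And>a. a \<notin> S \<Longrightarrow> Poly_Mapping.lookup (f a) p = 0"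
  shows "Poly_Mapping.lookup (lin_ext f x) p
    = (\<Sum>a\<in>S. Poly_Mapping.lookup x a * Poly_Mapping.lookup (f a) p)"
proof -
  have "Poly_Mapping.lookup (lin_ext f x) p
    = (\<Sum>a\<in>S \<union> Poly_Mapping.keys x. Poly_Mapping.lookup x a * Poly_Mapping.lookup (f a) p)"
    by (subst lin_ext_eq_sum[of "S \<union> Poly_Mapping.keys x"]) (use assms in \<open>auto simp: lookup_sum\<close>)
  also have "\<dots> = (\<Sum>a\<in>S. Poly_Mapping.lookup x a * Poly_Mapping.lookup (f a) p)"
    by (rule sum.mono_neutral_right) (use assms in auto)
  finally show ?thesis .
qed

lemma bilin_ext_add_left: "bilin_ext f (x + x') y = bilin_ext f x y + bilin_ext f x' y"
  by (simp add: bilin_ext_def lin_ext_add)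

lemma bilin_ext_add_right: "bilin_ext f x (y + y') = bilin_ext f x y + bilin_ext f x y'"
  by (simp add: bilin_ext_def lin_ext_add lin_ext_plus_fun)

lemma bilin_ext_smul_left: "bilin_ext f (c \<cdot> x) y = c \<cdot> bilin_ext f x y"
  by (simp add: bilin_ext_def lin_ext_smul)

lemma bilin_ext_smul_right: "bilin_ext f x (c \<cdot> y) = c \<cdot> bilin_ext f x y"
  by (simp add: bilin_ext_def lin_ext_smul lin_ext_smul_fun)

lemma bilin_ext_zero [simp]: "bilin_ext f 0 y = 0" "bilin_ext f x 0 = 0"
  by (simp_all add: bilin_ext_def lin_ext_def)

lemma bilin_ext_bvec [simp]: "bilin_ext f (bvec a) (bvec b) = f a b"
  by (simp add: bilin_ext_def)

lemma bilin_ext_bvec_left: "bilin_ext f (bvec a) y = lin_ext (f a) y"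
  by (simp add: bilin_ext_def)

lemma lookup_tensor [simp]:
  "Poly_Mapping.lookup (x \<otimes> y) (a, b) = Poly_Mapping.lookup x a * Poly_Mapping.lookup y b"
proof (induction x rule: cvec_induct)
  case (basis c a')
  show ?case
    by (induction y rule: cvec_induct)
      (auto simp: tensor_def bilin_ext_smul_left bilin_ext_smul_right bilin_ext_add_right lookup_add
        lookup_single when_def algebra_simps)
qed (auto simp: tensor_def bilin_ext_add_left lookup_add algebra_simps)

lemma tensor_add_left: "(x + x') \<otimes> y = x \<otimes> y + x' \<otimes> y"
  by (simp add: tensor_def bilin_ext_add_left)

lemma tensor_add_right: "x \<otimes> (y + y') = x \<otimes> y + x \<otimes> y'"
  by (simp add: tensor_def bilin_ext_add_right)

lemma tensor_smul_left: "(c \<cdot> x) \<otimes> y = c \<cdot> (x \<otimes> y)"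
  by (simp add: tensor_def bilin_ext_smul_left)

lemma tensor_smul_right: "x \<otimes> (c \<cdot> y) = c \<cdot> (x \<otimes> y)"
  by (simp add: tensor_def bilin_ext_smul_right)

lemma tensor_zero [simp]: "0 \<otimes> y = 0" "x \<otimes> 0 = 0"
  by (simp_all add: tensor_def)

lemma tensor_uminus [simp]: "(- x) \<otimes> y = - (x \<otimes> y)" "x \<otimes> (- y) = - (x \<otimes> y)"
  by (auto intro!: poly_mapping_eqI)

lemma tensor_diff: "(x - x') \<otimes> y = x \<otimes> y - x' \<otimes> y" "x \<otimes> (y - y') = x \<otimes> y - x \<otimes> y'"
  using tensor_add_left[of x "- x'" y] tensor_add_right[of x y "- y'"] by simp_all

lemma tensor_bvec [simp]: "bvec a \<otimes> bvec b = bvec (a, b)"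
  by (simp add: tensor_def)

lemma smul_one [simp]: "1 \<cdot> x = x"
  by (rule poly_mapping_eqI) simp

lemma smul_minus_one [simp]: "(- 1) \<cdot> x = - x"
  by (rule poly_mapping_eqI) simp

lemmas multilinear = lin_ext_add lin_ext_smul bilin_ext_add_left bilin_ext_add_right
  bilin_ext_smul_left bilin_ext_smul_right tensor_add_left tensor_add_right tensor_smul_left
  tensor_smul_right cvec.scale_right_distrib

lemma clinear_add: "clinear f \<Longrightarrow> f (x + y) = f x + f y"
  and clinear_smul: "clinear f \<Longrightarrow> f (c \<cdot> x) = c \<cdot> f x"
  by (simp_all add: Vector_Spaces.linear_iff)

lemma clinear_zero: "clinear f \<Longrightarrow> f 0 = 0"
  using clinear_smul[of f 0 0] by simp

lemma clinear_uminus: "clinear f \<Longrightarrow> f (- x) = - f x"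
  using clinear_smul[of f "-1" x] by simp

lemma clinearI: "(\<And>x y. f (x + y) = f x + f y) \<Longrightarrow> (\<And>c x. f (c \<cdot> x) = c \<cdot> f x) \<Longrightarrow> clinear f"
  by (simp add: Vector_Spaces.linear_iff cvec.vector_space_axioms)

lemma clinear_eqI:
  assumes "clinear f" "clinear h" "\<And>a. f (bvec a) = h (bvec a)"
  shows "f x = h x"
  by (induction x rule: cvec_induct)
    (use assms in \<open>simp_all add: clinear_zero clinear_add clinear_smul\<close>)

section \<open>Slotwise operators on a tensor product\<close>

definition col :: "'m \<Rightarrow> ('a \<times> 'm) cvec \<Rightarrow> 'a cvec"
  where "col m = lin_ext (\<lambda>(a, m'). if m' = m then bvec a else 0)"

definition row :: "'a \<Rightarrow> ('a \<times> 'm) cvec \<Rightarrow> 'm cvec"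
  where "row a = lin_ext (\<lambda>(a', m). if a' = a then bvec m else 0)"

lemma lookup_col [simp]: "Poly_Mapping.lookup (col m v) a = Poly_Mapping.lookup v (a, m)"
  unfolding col_def
  by (subst lookup_lin_ext[of "{(a, m)}"]) (auto simp: lookup_single when_def split: if_splits)

lemma lookup_row [simp]: "Poly_Mapping.lookup (row a v) m = Poly_Mapping.lookup v (a, m)"
  unfolding row_def
  by (subst lookup_lin_ext[of "{(a, m)}"]) (auto simp: lookup_single when_def split: if_splits)

text \<open>
  Both actions of the algebra, on the double and on the triple tensor power, and the homotopies
  below are operators of this one shape: \<open>A\<close> works on the first leg, and \<open>B a\<close> on the rest, where the
  dependence on the first leg \<open>a\<close> carries the sign rule.
\<close>

definition slots :: "('a \<Rightarrow> 'a cvec) \<Rightarrow> ('a \<Rightarrow> 'm \<Rightarrow> 'm cvec) \<Rightarrow> ('a \<times> 'm) cvec \<Rightarrow> ('a \<times> 'm) cvec"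
  where "slots A B = lin_ext (\<lambda>(a, m). A a \<otimes> bvec m + bvec a \<otimes> B a m)"

text \<open>
  A coordinate of such an operator involves only one column and one row of the tensor.  All later
  computations in the square and the cube of the algebra become scalar identities through this lemma.
\<close>

lemma lookup_slots:
  "Poly_Mapping.lookup (slots A B v) (p, m)
    = Poly_Mapping.lookup (lin_ext A (col m v)) p + Poly_Mapping.lookup (lin_ext (B p) (row p v)) m"
proof (induction v rule: cvec_induct)
  case (basis c am)
  show ?case
    by (cases am) (auto simp: slots_def col_def row_def multilinear lookup_add lookup_single when_def)
qed (auto simp: slots_def col_def row_def multilinear lookup_add)

section \<open>Tensor powers of a Lie superalgebra\<close>

lemma lin_ext_clinear: "clinear f \<Longrightarrow> lin_ext (\<lambda>a. f (bvec a)) x = f x"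
  by (induction x rule: cvec_induct)
    (simp_all add: clinear_zero clinear_add clinear_smul lin_ext_add lin_ext_smul)

lemma bit_exhaust: obtains "i = (0 :: bit)" | "i = 1"
  by (cases i) auto

lemma bit_moves:
  fixes i j k l :: bit
  shows "i + j = k \<Longrightarrow> i = k - j" "i + j = k \<Longrightarrow> j = k - i"
    "i = k + (l - j) \<Longrightarrow> i + j = k + l" "j = k + (l - i) \<Longrightarrow> i + j = k + l"
  by (cases i rule: bit_exhaust; cases j rule: bit_exhaust; cases k rule: bit_exhaust;
      cases l rule: bit_exhaust; simp)+

lemma ksign_simps [simp]: "ksign 0 = 1" "ksign 1 = - 1"
  by (simp_all add: ksign_def)

definition tensor_par :: "('b \<Rightarrow> bit) \<Rightarrow> 'b \<times> 'b \<Rightarrow> bit"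
  where "tensor_par par = (\<lambda>(a, b). par a + par b)"

definition skew :: "('b \<Rightarrow> bit) \<Rightarrow> ('b \<times> 'b) cvec \<Rightarrow> bool"
  where "skew par v \<longleftrightarrow> super_twist par v = - v"

lemma super_twist_tensor:
  assumes "A \<in> homog par i" "B \<in> homog par j"
  shows "super_twist par (A \<otimes> B) = ksign (i * j) \<cdot> (B \<otimes> A)"
  using assms(1)
proof (induction A rule: homog_induct)
  case (basis c a)
  show ?case using assms(2)
    by (induction B rule: homog_induct)
      (simp_all add: super_twist_def multilinear basis mult_ac)
qed (simp_all add: super_twist_def multilinear)

lemma super_twist_add: "super_twist par (x + y) = super_twist par x + super_twist par y"
  and super_twist_smul: "super_twist par (c \<cdot> x) = c \<cdot> super_twist par x"
  and super_twist_zero [simp]: "super_twist par 0 = 0"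
  by (simp_all add: super_twist_def multilinear)

lemma lookup_super_twist:
  "Poly_Mapping.lookup (super_twist par v) (a, b)
    = ksign (par a * par b) * Poly_Mapping.lookup v (b, a)"
  unfolding super_twist_def
  by (subst lookup_lin_ext[of "{(b, a)}"])
    (auto simp: lookup_single when_def mult_ac split: if_splits)

lemma super_twist_uminus: "super_twist par (- x) = - super_twist par x"
  using super_twist_smul[of par "-1" x] by simp

lemma super_twist_diff: "super_twist par (x - y) = super_twist par x - super_twist par y"
  using super_twist_add[of par x "- y"] by (simp add: super_twist_uminus)

lemma skew_lookup:
  "skew par v \<longleftrightarrow> (\<forall>a b. Poly_Mapping.lookup v (a, b)
     = - (ksign (par a * par b) * Poly_Mapping.lookup v (b, a)))"
  unfolding skew_def poly_mapping_eq_iff fun_eq_iff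
  by (auto simp: lookup_super_twist minus_equation_iff)

lemma ksign_square [simp]: "ksign i * ksign i = 1"
  by (cases i rule: bit_exhaust) auto

lemma super_twist_twice: "super_twist par (super_twist par v) = v"
  by (rule poly_mapping_eqI)
    (auto simp: lookup_super_twist mult.assoc[symmetric] mult.commute[of "par _"])

text \<open>
  Since $\tau^2 = 1$, the image of $1 - \tau$ is the kernel of $1 + \tau$; being skew is thus a
  condition on coordinates.
\<close>

lemma skew_iff_im_one_minus_twist: "skew par v \<longleftrightarrow> v \<in> im_one_minus_twist par"
proof
  assume "skew par v"
  then have "v = (1/2) \<cdot> v - super_twist par ((1/2) \<cdot> v)"
    by (intro poly_mapping_eqI) (simp add: skew_def super_twist_smul lookup_minus lookup_add)
  then show "v \<in> im_one_minus_twist par" by (auto simp: im_one_minus_twist_def)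
next
  assume "v \<in> im_one_minus_twist par"
  then obtain t where "v = t - super_twist par t" by (auto simp: im_one_minus_twist_def)
  then show "skew par v"
    by (simp add: skew_def super_twist_twice super_twist_diff)
qed

context lie_superalgebra
begin

lemmas br_simps = clinear_add[OF linear_left] clinear_smul[OF linear_left]
  clinear_zero[OF linear_left] clinear_add[OF linear_right] clinear_smul[OF linear_right]
  clinear_zero[OF linear_right] clinear_uminus[OF linear_left] clinear_uminus[OF linear_right]

lemma br_homog [simp]: "br (bvec x) (bvec y) \<in> homog par (par x + par y)"
  by (rule graded) simp_all

lemma br_lin_ext: "lin_ext (\<lambda>a. br x (bvec a)) y = br x y"
  by (rule lin_ext_clinear[OF linear_right])

lemma adj_act_simps:
  "adj_act par br (x + x') v = adj_act par br x v + adj_act par br x' v"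
  "adj_act par br (c \<cdot> x) v = c \<cdot> adj_act par br x v"
  "adj_act par br 0 v = 0"
  "adj_act par br x (v + v') = adj_act par br x v + adj_act par br x v'"
  "adj_act par br x (c \<cdot> v) = c \<cdot> adj_act par br x v"
  "adj_act par br x 0 = 0"
  by (simp_all add: adj_act_def multilinear)

lemma adj_act_uminus: "adj_act par br x (- v) = - adj_act par br x v"
  using adj_act_simps(5)[of x "-1" v] by simp

lemma adj_act_diff: "adj_act par br x (v - w) = adj_act par br x v - adj_act par br x w"
  using adj_act_simps(4)[of x v "- w"] by (simp add: adj_act_uminus)

lemma adj_act_tensor:
  assumes "x \<in> homog par i" "A \<in> homog par j"
  shows "adj_act par br x (A \<otimes> B) = br x A \<otimes> B + ksign (i * j) \<cdot> (A \<otimes> br x B)"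
  using assms(1)
proof (induction x rule: homog_induct)
  case (basis c x)
  note x = basis
  show ?case using assms(2)
  proof (induction A rule: homog_induct)
    case (basis d a)
    then show ?case
      by (induction B rule: cvec_induct)
        (simp_all add: adj_act_def multilinear br_simps x algebra_simps)
  qed (simp_all add: adj_act_simps multilinear br_simps algebra_simps)
qed (simp_all add: adj_act_simps multilinear br_simps algebra_simps)

lemma adj_act_bvec:
  "adj_act par br (bvec x) v = slots (\<lambda>a. br (bvec x) (bvec a))
     (\<lambda>a b. ksign (par x * par a) \<cdot> br (bvec x) (bvec b)) v"
  by (simp add: adj_act_def bilin_ext_bvec_left slots_def multilinear case_prod_unfold
      tensor_smul_right)

lemma lookup_adj_act:
  "Poly_Mapping.lookup (adj_act par br (bvec x) v) (p, q)
    = Poly_Mapping.lookup (br (bvec x) (col q v)) p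
      + ksign (par x * par p) * Poly_Mapping.lookup (br (bvec x) (row p v)) q"
  by (simp add: adj_act_bvec lookup_slots lin_ext_smul_fun br_lin_ext)

text \<open>
  The diagonal action commutes with the twist, so it preserves skew tensors.
\<close>

lemma super_twist_adj_act:
  "super_twist par (adj_act par br (bvec x) v) = adj_act par br (bvec x) (super_twist par v)"
proof (induction v rule: cvec_induct)
  case (basis c ab)
  obtain a b where ab: "ab = (a, b)" by (cases ab)
  have "super_twist par (adj_act par br (bvec x) (bvec a \<otimes> bvec b))
      = adj_act par br (bvec x) (super_twist par (bvec a \<otimes> bvec b))"
    by (cases "par a" rule: bit_exhaust; cases "par b" rule: bit_exhaust;
        cases "par x" rule: bit_exhaust)
      (simp_all del: tensor_bvec add: adj_act_tensor[OF basis_homog basis_homog]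
        super_twist_tensor[OF basis_homog basis_homog]
        super_twist_tensor[OF br_homog basis_homog]
        super_twist_tensor[OF basis_homog br_homog]
        super_twist_add super_twist_diff super_twist_uminus super_twist_smul adj_act_simps adj_act_diff adj_act_uminus)
  then show ?case by (simp add: ab adj_act_simps super_twist_smul)
qed (simp_all add: adj_act_simps super_twist_add)

lemma skew_adj_act: "skew par v \<Longrightarrow> skew par (adj_act par br (bvec x) v)"
  by (simp add: skew_def super_twist_adj_act adj_act_uminus)

lemma homog_adj_act:
  assumes "v \<in> homog (tensor_par par) i"
  shows "adj_act par br (bvec x) v \<in> homog (tensor_par par) (par x + i)"
  unfolding homog_iff_lookup
proof (intro allI impI)
  fix pq assume nz: "Poly_Mapping.lookup (adj_act par br (bvec x) v) pq \<noteq> 0"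
  obtain p q where pq: "pq = (p, q)" by (cases pq)
  have v: "par a + par b = i" if "Poly_Mapping.lookup v (a, b) \<noteq> 0" for a b
    using assms that by (auto simp: homog_iff_lookup tensor_par_def)
  have "col q v \<in> homog par (i - par q)"
    unfolding homog_iff_lookup using v bit_moves by (metis lookup_col)
  then have 1: "br (bvec x) (col q v) \<in> homog par (par x + (i - par q))"
    by (intro graded) simp_all
  have "row p v \<in> homog par (i - par p)"
    unfolding homog_iff_lookup using v bit_moves by (metis lookup_row)
  then have 2: "br (bvec x) (row p v) \<in> homog par (par x + (i - par p))"
    by (intro graded) simp_all
  from nz have "Poly_Mapping.lookup (br (bvec x) (col q v)) p \<noteq> 0
      \<or> Poly_Mapping.lookup (br (bvec x) (row p v)) q \<noteq> 0"
    by (auto simp: pq lookup_adj_act)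
  with 1 2 have "par p = par x + (i - par q) \<or> par q = par x + (i - par p)"
    by (auto simp only: homog_iff_lookup)
  then show "tensor_par par pq = par x + i"
    by (auto simp: pq tensor_par_def intro: bit_moves)
qed

text \<open>
  The square of the algebra is a module: the Jacobi identity, leg by leg.
\<close>

lemma adj_act_br:
  "adj_act par br (br (bvec x) (bvec y)) v = adj_act par br (bvec x) (adj_act par br (bvec y) v)
     - ksign (par x * par y) \<cdot> adj_act par br (bvec y) (adj_act par br (bvec x) v)"
proof (induction v rule: cvec_induct)
  case (basis c ab)
  obtain a b where ab: "ab = (a, b)" by (cases ab)
  have jac: "br (bvec x) (br (bvec y) (bvec z)) = br (br (bvec x) (bvec y)) (bvec z)
      + ksign (par x * par y) \<cdot> br (bvec y) (br (bvec x) (bvec z))" for z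
    by (rule super_jacobi) simp_all
  note * = adj_act_tensor[OF basis_homog basis_homog]
    adj_act_tensor[OF basis_homog br_homog]
    adj_act_tensor[OF br_homog basis_homog]
  have "adj_act par br (br (bvec x) (bvec y)) (bvec a \<otimes> bvec b)
    = adj_act par br (bvec x) (adj_act par br (bvec y) (bvec a \<otimes> bvec b))
     - ksign (par x * par y) \<cdot> adj_act par br (bvec y) (adj_act par br (bvec x) (bvec a \<otimes> bvec b))"
    by (cases "par a" rule: bit_exhaust; cases "par y" rule: bit_exhaust;
        cases "par x" rule: bit_exhaust)
      (simp_all del: tensor_bvec add: * adj_act_simps adj_act_uminus adj_act_diff jac tensor_add_left
        tensor_add_right tensor_diff algebra_simps)
  then show ?case
    by (simp add: ab adj_act_simps multilinear cvec.scale_right_diff_distrib mult.commute)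
next
  case (add v w)
  show ?case
    by (simp only: adj_act_simps add cvec.scale_right_distrib) (simp only: algebra_simps)
qed (simp add: adj_act_simps)

end

section \<open>Leg brackets and the classical Yang-Baxter element\<close>

lemma tensor_par_simp [simp]: "tensor_par par (a, b) = par a + par b"
  by (simp add: tensor_par_def)

text \<open>
  The three summands of $c(r)$ are polarised to bilinear maps of two tensors $r$, $s$, because the
  co-Jacobi identity of a coboundary pairs $r$ with $x * r$.
\<close>

definition r12_r13 where
  "r12_r13 par br = bilin_ext (\<lambda>(a, b) (a', b').
    ksign (par a' * par b) \<cdot> (br (bvec a) (bvec a') \<otimes> bvec b \<otimes> bvec b'))"

definition r12_r23 where
  "r12_r23 br = bilin_ext (\<lambda>(a, b) (a', b'). bvec a \<otimes> br (bvec b) (bvec a') \<otimes> bvec b')"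

definition r13_r23 where
  "r13_r23 par br = bilin_ext (\<lambda>(a, b) (a', b').
    ksign (par a' * par b) \<cdot> (bvec a \<otimes> bvec a' \<otimes> br (bvec b) (bvec b')))"

definition triple_act where
  "triple_act par br x = slots (\<lambda>a. br (bvec x) (bvec a))
     (\<lambda>a m. ksign (par x * par a) \<cdot> adj_act par br (bvec x) (bvec m))"

lemma super_cyclic_simps:
  "super_cyclic par (x + y) = super_cyclic par x + super_cyclic par y"
  "super_cyclic par (c \<cdot> x) = c \<cdot> super_cyclic par x"
  "super_cyclic par 0 = 0"
  by (simp_all add: super_cyclic_def multilinear)

lemma super_cyclic_uminus: "super_cyclic par (- x) = - super_cyclic par x"
  using super_cyclic_simps(2)[of par "-1" x] by simp

lemma super_cyclic_tensor:
  assumes "A \<in> homog par i" "B \<in> homog par j" "C \<in> homog par k"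
  shows "super_cyclic par (A \<otimes> B \<otimes> C) = ksign (i * (j + k)) \<cdot> (B \<otimes> C \<otimes> A)"
  using assms(1)
proof (induction A rule: homog_induct)
  case (basis c a)
  note a = basis
  show ?case using assms(2)
  proof (induction B rule: homog_induct)
    case (basis d b)
    note b = basis
    show ?case using assms(3)
      by (induction C rule: homog_induct)
        (simp_all add: super_cyclic_def multilinear a b mult.left_commute)
  qed (simp_all add: super_cyclic_simps multilinear)
qed (simp_all add: super_cyclic_simps multilinear)

lemma cybe_split: "cybe par br r = r12_r13 par br r r + r12_r23 br r r + r13_r23 par br r r"
  by (simp add: cybe_def r12_r13_def r12_r23_def r13_r23_def bilin_ext_def case_prod_unfold
      lin_ext_plus_fun)

lemmas leg_bracket_defs = r12_r13_def r12_r23_def r13_r23_def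

lemma triple_act_simps:
  "triple_act par br x (z + z') = triple_act par br x z + triple_act par br x z'"
  "triple_act par br x (c \<cdot> z) = c \<cdot> triple_act par br x z"
  "triple_act par br x 0 = 0"
  by (simp_all add: triple_act_def slots_def multilinear)

lemma leg_bracket_simps:
  "r12_r13 par br (u + u') v = r12_r13 par br u v + r12_r13 par br u' v"
  "r12_r13 par br (c \<cdot> u) v = c \<cdot> r12_r13 par br u v"
  "r12_r13 par br u (v + v') = r12_r13 par br u v + r12_r13 par br u v'"
  "r12_r13 par br u (c \<cdot> v) = c \<cdot> r12_r13 par br u v"
  "r12_r13 par br 0 v = 0" "r12_r13 par br u 0 = 0"
  "r12_r23 br (u + u') v = r12_r23 br u v + r12_r23 br u' v"
  "r12_r23 br (c \<cdot> u) v = c \<cdot> r12_r23 br u v"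
  "r12_r23 br u (v + v') = r12_r23 br u v + r12_r23 br u v'"
  "r12_r23 br u (c \<cdot> v) = c \<cdot> r12_r23 br u v"
  "r12_r23 br 0 v = 0" "r12_r23 br u 0 = 0"
  "r13_r23 par br (u + u') v = r13_r23 par br u v + r13_r23 par br u' v"
  "r13_r23 par br (c \<cdot> u) v = c \<cdot> r13_r23 par br u v"
  "r13_r23 par br u (v + v') = r13_r23 par br u v + r13_r23 par br u v'"
  "r13_r23 par br u (c \<cdot> v) = c \<cdot> r13_r23 par br u v"
  "r13_r23 par br 0 v = 0" "r13_r23 par br u 0 = 0"
  by (simp_all add: leg_bracket_defs multilinear)

lemma leg_bracket_uminus:
  "r12_r13 par br (- u) v = - r12_r13 par br u v" "r12_r13 par br u (- v) = - r12_r13 par br u v"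
  "r12_r23 br (- u) v = - r12_r23 br u v" "r12_r23 br u (- v) = - r12_r23 br u v"
  "r13_r23 par br (- u) v = - r13_r23 par br u v" "r13_r23 par br u (- v) = - r13_r23 par br u v"
  using leg_bracket_simps(2)[of par br "-1" u v] leg_bracket_simps(4)[of par br u "-1" v]
    leg_bracket_simps(8)[of br "-1" u v] leg_bracket_simps(10)[of br u "-1" v]
    leg_bracket_simps(14)[of par br "-1" u v] leg_bracket_simps(16)[of par br u "-1" v]
  by simp_all

context lie_superalgebra
begin

lemma leg_bracket_tensor:
  assumes "B \<in> homog par j" "A' \<in> homog par k"
  shows "r12_r13 par br (A \<otimes> B) (A' \<otimes> B') = ksign (k * j) \<cdot> (br A A' \<otimes> B \<otimes> B')" (is ?P)
    and "r12_r23 br (A \<otimes> B) (A' \<otimes> B') = A \<otimes> br B A' \<otimes> B'" (is ?Q)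
    and "r13_r23 par br (A \<otimes> B) (A' \<otimes> B') = ksign (k * j) \<cdot> (A \<otimes> A' \<otimes> br B B')" (is ?R)
proof -
  have "?P \<and> ?Q \<and> ?R"
  proof (induction A rule: cvec_induct)
    case (basis c a)
    show ?case using assms(1)
    proof (induction B rule: homog_induct)
      case (basis d b)
      note b = basis
      show ?case using assms(2)
      proof (induction A' rule: homog_induct)
        case (basis e a')
        note a' = basis
        show ?case
          by (induction B' rule: cvec_induct)
            (simp_all add: leg_bracket_defs multilinear a' b br_simps mult.left_commute)
      qed (auto simp: leg_bracket_simps multilinear br_simps)
    qed (auto simp: leg_bracket_simps multilinear br_simps)
  qed (simp_all add: leg_bracket_simps multilinear br_simps)
  then show ?P ?Q ?R by auto
qed

lemma adj_act_lin_ext: "lin_ext (\<lambda>a. adj_act par br x (bvec a)) v = adj_act par br x v"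
  by (rule lin_ext_clinear[OF clinearI]) (simp_all add: adj_act_simps)

lemma triple_act_tensor:
  assumes "A \<in> homog par i"
  shows "triple_act par br x (A \<otimes> M)
    = br (bvec x) A \<otimes> M + ksign (par x * i) \<cdot> (A \<otimes> adj_act par br (bvec x) M)"
  using assms
proof (induction A rule: homog_induct)
  case (basis c a)
  then show ?case
    by (induction M rule: cvec_induct)
      (simp_all add: triple_act_def slots_def multilinear br_simps adj_act_simps algebra_simps)
qed (simp_all add: triple_act_simps multilinear br_simps algebra_simps)

text \<open>
  Each leg bracket is equivariant, by the Jacobi identity in the leg where a bracket is taken and the
  sign rule in the other two.
\<close>

lemma triple_act_leg_bracket_basis:
  fixes a b a' b' x
  defines "u \<equiv> bvec a \<otimes> bvec b" and "v \<equiv> bvec a' \<otimes> bvec b'"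
    and "s \<equiv> ksign (par x * (par a + par b))"
  shows "triple_act par br x (r12_r13 par br u v)
      = r12_r13 par br (adj_act par br (bvec x) u) v + s \<cdot> r12_r13 par br u (adj_act par br (bvec x) v)"
    and "triple_act par br x (r12_r23 br u v)
      = r12_r23 br (adj_act par br (bvec x) u) v + s \<cdot> r12_r23 br u (adj_act par br (bvec x) v)"
    and "triple_act par br x (r13_r23 par br u v)
      = r13_r23 par br (adj_act par br (bvec x) u) v + s \<cdot> r13_r23 par br u (adj_act par br (bvec x) v)"
proof -
  have jac: "br (bvec x) (br (bvec y) (bvec z)) = br (br (bvec x) (bvec y)) (bvec z)
      + ksign (par x * par y) \<cdot> br (bvec y) (br (bvec x) (bvec z))" for y z
    by (rule super_jacobi) simp_all
  note rules = adj_act_tensor[OF basis_homog basis_homog] adj_act_tensor[OF basis_homog br_homog]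
    leg_bracket_tensor[OF basis_homog basis_homog] leg_bracket_tensor[OF br_homog basis_homog]
    leg_bracket_tensor[OF basis_homog br_homog]
    triple_act_tensor[OF basis_homog] triple_act_tensor[OF br_homog]
    leg_bracket_simps leg_bracket_uminus adj_act_simps adj_act_uminus
    triple_act_simps triple_act_simps(2)[of par br x "-1", simplified] tensor_diff
    jac tensor_add_left tensor_add_right
  have diffs: "r12_r13 par br (w - w') v = r12_r13 par br w v - r12_r13 par br w' v"
    "r12_r13 par br w (z - z') = r12_r13 par br w z - r12_r13 par br w z'"
    "r12_r23 br (w - w') v = r12_r23 br w v - r12_r23 br w' v"
    "r12_r23 br w (z - z') = r12_r23 br w z - r12_r23 br w z'"
    "r13_r23 par br (w - w') v = r13_r23 par br w v - r13_r23 par br w' v"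
    "r13_r23 par br w (z - z') = r13_r23 par br w z - r13_r23 par br w z'" for w w' z z' v
    using leg_bracket_simps(1)[of par br w "- w'" v] leg_bracket_simps(3)[of par br w z "- z'"]
      leg_bracket_simps(7)[of br w "- w'" v] leg_bracket_simps(9)[of br w z "- z'"]
      leg_bracket_simps(13)[of par br w "- w'" v] leg_bracket_simps(15)[of par br w z "- z'"]
    by (simp_all add: leg_bracket_uminus)
  show "triple_act par br x (r12_r13 par br u v)
      = r12_r13 par br (adj_act par br (bvec x) u) v + s \<cdot> r12_r13 par br u (adj_act par br (bvec x) v)"
    unfolding u_def v_def s_def
    by (cases "par a" rule: bit_exhaust; cases "par b" rule: bit_exhaust;
        cases "par a'" rule: bit_exhaust; cases "par x" rule: bit_exhaust)
      (simp_all del: tensor_bvec add: rules diffs algebra_simps)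
  show "triple_act par br x (r12_r23 br u v)
      = r12_r23 br (adj_act par br (bvec x) u) v + s \<cdot> r12_r23 br u (adj_act par br (bvec x) v)"
    unfolding u_def v_def s_def
    by (cases "par a" rule: bit_exhaust; cases "par b" rule: bit_exhaust;
        cases "par a'" rule: bit_exhaust; cases "par x" rule: bit_exhaust)
      (simp_all del: tensor_bvec add: rules diffs algebra_simps)
  show "triple_act par br x (r13_r23 par br u v)
      = r13_r23 par br (adj_act par br (bvec x) u) v + s \<cdot> r13_r23 par br u (adj_act par br (bvec x) v)"
    unfolding u_def v_def s_def
    by (cases "par a" rule: bit_exhaust; cases "par b" rule: bit_exhaust;
        cases "par a'" rule: bit_exhaust; cases "par x" rule: bit_exhaust)
      (simp_all del: tensor_bvec add: rules diffs algebra_simps)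
qed

lemma triple_act_cybe:
  assumes "r \<in> homog (tensor_par par) 0"
  shows "triple_act par br x (cybe par br r)
    = r12_r13 par br (adj_act par br (bvec x) r) r + r12_r13 par br r (adj_act par br (bvec x) r)
    + (r12_r23 br (adj_act par br (bvec x) r) r + r12_r23 br r (adj_act par br (bvec x) r))
    + (r13_r23 par br (adj_act par br (bvec x) r) r + r13_r23 par br r (adj_act par br (bvec x) r))"
proof -
  have "triple_act par br x (r12_r13 par br r s)
      = r12_r13 par br (adj_act par br (bvec x) r) s + r12_r13 par br r (adj_act par br (bvec x) s)
    \<and> triple_act par br x (r12_r23 br r s)
      = r12_r23 br (adj_act par br (bvec x) r) s + r12_r23 br r (adj_act par br (bvec x) s)
    \<and> triple_act par br x (r13_r23 par br r s)
      = r13_r23 par br (adj_act par br (bvec x) r) s + r13_r23 par br r (adj_act par br (bvec x) s)"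
    for s using assms
  proof (induction r rule: homog_induct)
    case (basis c u)
    obtain a b where u: "u = (a, b)" by (cases u)
    show ?case
    proof (induction s rule: cvec_induct)
      case (basis d v)
      obtain a' b' where v: "v = (a', b')" by (cases v)
      show ?case
        using triple_act_leg_bracket_basis[of x a b a' b'] \<open>tensor_par par u = 0\<close>
        by (simp del: add_bit_eq_xor mult_bit_eq_and
            add: u v triple_act_simps leg_bracket_simps adj_act_simps multilinear mult.commute)
    qed (simp_all add: triple_act_simps leg_bracket_simps adj_act_simps)
  qed (simp_all add: triple_act_simps leg_bracket_simps adj_act_simps)
  then show ?thesis by (simp add: cybe_split triple_act_simps)
qed

text \<open>
  Cyclic rotation permutes the three kinds of leg brackets.  It moves the leg that carries the bracket
  and leaves some of the remaining legs in the wrong order, which costs a twist of a factor.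
\<close>

lemma super_cyclic_leg_bracket_basis:
  fixes a b a' b'
  defines "u \<equiv> bvec a \<otimes> bvec b" and "v \<equiv> bvec a' \<otimes> bvec b'"
    and "s \<equiv> ksign ((par a + par b) * (par a' + par b'))"
  shows "super_cyclic par (r12_r13 par br u v)
      = r13_r23 par br (super_twist par u) (super_twist par v)"
    and "super_cyclic par (r12_r23 br u v) = - (s \<cdot> r12_r13 par br v (super_twist par u))"
    and "super_cyclic par (r13_r23 par br u v) = - (s \<cdot> r12_r23 br v (super_twist par u))"
proof -
  have sk: "br (bvec b) (bvec y) = - (ksign (par b * par y) \<cdot> br (bvec y) (bvec b))" for y
    by (rule super_skew) simp_all
  note rules = super_twist_tensor[OF basis_homog basis_homog]
    leg_bracket_tensor[OF basis_homog basis_homog]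
    super_cyclic_tensor[OF basis_homog basis_homog basis_homog]
    super_cyclic_tensor[OF br_homog basis_homog basis_homog]
    super_cyclic_tensor[OF basis_homog br_homog basis_homog]
    super_cyclic_tensor[OF basis_homog basis_homog br_homog]
    leg_bracket_simps leg_bracket_uminus super_cyclic_simps super_cyclic_uminus
  show "super_cyclic par (r12_r13 par br u v)
      = r13_r23 par br (super_twist par u) (super_twist par v)"
    unfolding u_def v_def s_def
    by (cases "par a" rule: bit_exhaust; cases "par b" rule: bit_exhaust;
        cases "par a'" rule: bit_exhaust; cases "par b'" rule: bit_exhaust)
      (simp_all del: tensor_bvec add: rules)
  show "super_cyclic par (r12_r23 br u v) = - (s \<cdot> r12_r13 par br v (super_twist par u))"
    unfolding u_def v_def s_def
    by (cases "par a" rule: bit_exhaust; cases "par b" rule: bit_exhaust;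
        cases "par a'" rule: bit_exhaust; cases "par b'" rule: bit_exhaust)
      (simp_all del: tensor_bvec add: rules sk[of a'])
  show "super_cyclic par (r13_r23 par br u v) = - (s \<cdot> r12_r23 br v (super_twist par u))"
    unfolding u_def v_def s_def
    by (cases "par a" rule: bit_exhaust; cases "par b" rule: bit_exhaust;
        cases "par a'" rule: bit_exhaust; cases "par b'" rule: bit_exhaust)
      (simp_all del: tensor_bvec add: rules sk[of b'])
qed

lemma super_cyclic_leg_bracket:
  assumes "u \<in> homog (tensor_par par) i" "v \<in> homog (tensor_par par) j"
  shows "super_cyclic par (r12_r13 par br u v)
      = r13_r23 par br (super_twist par u) (super_twist par v)
    \<and> super_cyclic par (r12_r23 br u v) = - (ksign (i * j) \<cdot> r12_r13 par br v (super_twist par u))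
    \<and> super_cyclic par (r13_r23 par br u v) = - (ksign (i * j) \<cdot> r12_r23 br v (super_twist par u))"
  using assms(1)
proof (induction u rule: homog_induct)
  case (basis c u)
  obtain a b where u: "u = (a, b)" by (cases u)
  note u' = basis
  show ?case using assms(2)
  proof (induction v rule: homog_induct)
    case (basis d v)
    obtain a' b' where v: "v = (a', b')" by (cases v)
    show ?case
      using super_cyclic_leg_bracket_basis[of a b a' b'] u' basis
      by (simp del: add_bit_eq_xor mult_bit_eq_and
          add: u v super_cyclic_simps leg_bracket_simps super_twist_smul mult_ac)
  qed (auto simp: super_cyclic_simps leg_bracket_simps super_twist_add super_twist_smul
      cvec.scale_right_distrib)
qed (simp_all add: super_cyclic_simps leg_bracket_simps super_twist_add super_twist_smul
      cvec.scale_right_distrib)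

text \<open>
  For an inner cobracket, $(1 \otimes \Delta) s$ consists of two of the three leg brackets of $s$ with
  the potential; the cyclic sum in the co-Jacobi identity supplies the third.
\<close>

lemma id_tensor_eq:
  assumes "\<And>b. D (bvec b) = adj_act par br (bvec b) r"
  shows "id_tensor D s = r12_r23 br s r + r13_r23 par br s r"
proof (induction s rule: cvec_induct)
  case (basis c ab)
  obtain a b where ab: "ab = (a, b)" by (cases ab)
  have "bvec a \<otimes> adj_act par br (bvec b) r
      = r12_r23 br (bvec a \<otimes> bvec b) r + r13_r23 par br (bvec a \<otimes> bvec b) r"
  proof (induction r rule: cvec_induct)
    case (basis d u)
    obtain a' b' where u: "u = (a', b')" by (cases u)
    have "bvec a \<otimes> adj_act par br (bvec b) (bvec a' \<otimes> bvec b')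
      = r12_r23 br (bvec a \<otimes> bvec b) (bvec a' \<otimes> bvec b')
      + r13_r23 par br (bvec a \<otimes> bvec b) (bvec a' \<otimes> bvec b')"
      unfolding leg_bracket_tensor[OF basis_homog basis_homog]
        adj_act_tensor[OF basis_homog basis_homog]
      by (simp add: multilinear mult.commute)
    then show ?case by (simp add: u adj_act_simps leg_bracket_simps multilinear)
  qed (simp_all add: adj_act_simps leg_bracket_simps multilinear algebra_simps)
  then show ?case
    by (simp add: ab assms id_tensor_def multilinear leg_bracket_simps)
qed (simp_all add: id_tensor_def multilinear leg_bracket_simps algebra_simps)

text \<open>
  With $s = x * r$, the cyclic sum of $(1 \otimes \Delta) s$ runs through all six leg brackets of the
  pairs $(r, s)$ and $(s, r)$ exactly once.  By equivariance their total is $x * c(r)$, so the co-Jacobi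
  identity says that $c(r)$ is invariant.
\<close>

theorem co_jacobi_cybe:
  assumes r: "r \<in> homog (tensor_par par) 0" "skew par r"
    and D: "\<And>b. D (bvec b) = adj_act par br (bvec b) r"
    and j: "id_tensor D (D (bvec x)) + super_cyclic par (id_tensor D (D (bvec x)))
      + super_cyclic par (super_cyclic par (id_tensor D (D (bvec x)))) = 0"
  shows "triple_act par br x (cybe par br r) = 0"
proof -
  define s where "s = adj_act par br (bvec x) r"
  have s: "s \<in> homog (tensor_par par) (par x)" "skew par s"
    using homog_adj_act[OF r(1), of x] skew_adj_act[OF r(2), of x] by (simp_all del: add_bit_eq_xor add: s_def)
  have c: "super_cyclic par (r12_r13 par br u v) = r13_r23 par br u v"
      "super_cyclic par (r12_r23 br u v) = r12_r13 par br v u"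
      "super_cyclic par (r13_r23 par br u v) = r12_r23 br v u"
    if "u \<in> homog (tensor_par par) i" "v \<in> homog (tensor_par par) j"
      "i * j = 0" "skew par u" "skew par v"
    for u v i j
    using super_cyclic_leg_bracket[OF that(1,2)] that(3-5)
    by (simp_all only: skew_def leg_bracket_uminus ksign_simps smul_one minus_minus)
  \<comment> \<open>one of the two tensors is even, so the sign of their exchange is $1$\<close>
  note c1 = c[OF s(1) r(1) _ s(2) r(2), simplified] c[OF r(1) s(1) _ r(2) s(2), simplified]
  have "triple_act par br x (cybe par br r)
      = id_tensor D s + super_cyclic par (id_tensor D s)
        + super_cyclic par (super_cyclic par (id_tensor D s))"
    by (simp add: triple_act_cybe[OF r(1)] id_tensor_eq[OF D] s_def[symmetric]
        super_cyclic_simps c1 algebra_simps)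
  then show ?thesis using j by (simp add: D s_def)
qed

end

section \<open>The $N=2$ algebra in coordinates\<close>

abbreviation coord :: "'a cvec \<Rightarrow> 'a \<Rightarrow> complex"  (infixl \<open>\<bullet>\<close> 90)
  where "v \<bullet> a \<equiv> Poly_Mapping.lookup v a"

lemmas single_simps = lookup_single when_def

lemma coord_lin_ext_ns2:
  assumes "finite S" "\<And>n. LL n \<notin> S \<Longrightarrow> f (LL n) \<bullet> p = 0" "\<And>n. II n \<notin> S \<Longrightarrow> f (II n) \<bullet> p = 0"
    "\<And>n. GP n \<notin> S \<Longrightarrow> f (GP n) \<bullet> p = 0" "\<And>n. GM n \<notin> S \<Longrightarrow> f (GM n) \<bullet> p = 0"
    "CC \<notin> S \<Longrightarrow> f CC \<bullet> p = 0"
  shows "lin_ext f y \<bullet> p = (\<Sum>a\<in>S. y \<bullet> a * f a \<bullet> p)"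
proof (rule lookup_lin_ext)
  show "f a \<bullet> p = 0" if "a \<notin> S" for a using that assms by (cases a) auto
qed (rule assms)

lemmas ns2_coord_simps = single_simps ns2_GG_def lookup_add lookup_minus half_mode_def

text \<open>
  In the mode numbering of \<open>GP k\<close>, the central coordinate carries the factor
  $(k^2 + k)/3 = (p^2 - 1/4)/3$.  It vanishes for $k = 0$ and $k = -1$, which makes these two elements
  the best behaved ones.
\<close>

lemma coord_br_GP:
  "ns2_br (bvec (GP k)) y \<bullet> GP c
    = (3 * of_int k + 1 - of_int c) / 2 * (y \<bullet> LL (c - k)) - y \<bullet> II (c - k)"
  "ns2_br (bvec (GP k)) y \<bullet> LL n = 2 * (y \<bullet> GM (n - k - 1))"
  "ns2_br (bvec (GP k)) y \<bullet> II n = (2 * of_int k + 1 - of_int n) * (y \<bullet> GM (n - k - 1))"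
  "ns2_br (bvec (GP k)) y \<bullet> CC = (of_int k * of_int k + of_int k) / 3 * (y \<bullet> GM (- k - 1))"
  "ns2_br (bvec (GP k)) y \<bullet> GM c = 0"
  unfolding ns2_br_def bilin_ext_bvec_left
  \<comment> \<open>each coordinate meets the basis vectors in one of the listed sets; the right set is found by
    backtracking\<close>
  by (subst coord_lin_ext_ns2[of "{LL (c - k), II (c - k)}"] coord_lin_ext_ns2[of "{GM (n - k - 1)}"]
      coord_lin_ext_ns2[of "{GM (- k - 1)}"] coord_lin_ext_ns2[of "{}"];
      auto simp: ns2_coord_simps field_simps power2_eq_square; fail)+

lemma coord_br_GM:
  "ns2_br (bvec (GM k)) y \<bullet> LL n = 2 * (y \<bullet> GP (n - k - 1))"
  unfolding ns2_br_def bilin_ext_bvec_left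
  by (subst coord_lin_ext_ns2[of "{GP (n - k - 1)}"]) (auto simp: ns2_coord_simps)

lemma coord_br_I0:
  "ns2_br (bvec (II 0)) y \<bullet> p = (case p of GP c \<Rightarrow> y \<bullet> p | GM c \<Rightarrow> - (y \<bullet> p) | _ \<Rightarrow> 0)"
  unfolding ns2_br_def bilin_ext_bvec_left
  by (subst coord_lin_ext_ns2[of "{p}"]) (auto simp: ns2_coord_simps split: ns2_basis.split)

lemma coord_br_LL:
  "ns2_br (bvec (LL m)) y \<bullet> LL n = (2 * of_int m - of_int n) * (y \<bullet> LL (n - m))"
  "ns2_br (bvec (LL m)) y \<bullet> II n = (of_int m - of_int n) * (y \<bullet> II (n - m))"
  unfolding ns2_br_def bilin_ext_bvec_left
  by (subst coord_lin_ext_ns2[of "{LL (n - m)}"] coord_lin_ext_ns2[of "{II (n - m)}"];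
      auto simp: ns2_coord_simps; fail)+

lemma ns2_br_bvec: "ns2_br (bvec a) (bvec b) = ns2_br_basis a b"
  by (simp add: ns2_br_def)

section \<open>Contracting homotopies for two odd differentials\<close>

text \<open>
  On the span of the basis vectors other than \<open>CC\<close>, the two differentials \<open>GP 0\<close> and \<open>GP (- 1)\<close>
  generate a Grassmann algebra over which the vectors \<open>GM j\<close> form a free basis: \<open>GP 0\<close> and \<open>GP (- 1)\<close>
  send them to vectors that together span the \<open>LL\<close> and \<open>II\<close> part, and their product sends \<open>GM n\<close>
  to \<open>2 \<cdot> GP n\<close>.  The maps \<open>lower_GP_0\<close> and \<open>lower_GP_minus_1\<close> are the partial derivatives with
  respect to the two Grassmann generators, written in the given basis.
\<close>

fun lower_GP_0 :: "ns2_basis \<Rightarrow> ns2_basis cvec" where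
  "lower_GP_0 (LL n) = ((of_int n + 1) / 4) \<cdot> bvec (GM (n - 1))"
| "lower_GP_0 (II n) = (1 / 2) \<cdot> bvec (GM (n - 1))"
| "lower_GP_0 (GP n) = bvec (LL n) - ((of_int n + 1) / 2) \<cdot> bvec (II n)"
| "lower_GP_0 _ = 0"

fun lower_GP_minus_1 :: "ns2_basis \<Rightarrow> ns2_basis cvec" where
  "lower_GP_minus_1 (LL n) = ((1 - of_int n) / 4) \<cdot> bvec (GM n)"
| "lower_GP_minus_1 (II n) = (- 1 / 2) \<cdot> bvec (GM n)"
| "lower_GP_minus_1 (GP n) = (of_int n / 2) \<cdot> bvec (II (n + 1)) - bvec (LL (n + 1))"
| "lower_GP_minus_1 _ = 0"

lemma coord_lower_GP_0:
  "lin_ext lower_GP_0 y \<bullet> GM j = (of_int j + 2) / 4 * (y \<bullet> LL (j + 1)) + (y \<bullet> II (j + 1)) / 2"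
  "lin_ext lower_GP_0 y \<bullet> LL n = y \<bullet> GP n"
  "lin_ext lower_GP_0 y \<bullet> II n = - (of_int n + 1) / 2 * (y \<bullet> GP n)"
  "lin_ext lower_GP_0 y \<bullet> GP n = 0"
  "lin_ext lower_GP_0 y \<bullet> CC = 0"
  by (subst coord_lin_ext_ns2[of "{LL (j + 1), II (j + 1)}"] coord_lin_ext_ns2[of "{GP n}"]
      coord_lin_ext_ns2[of "{}"]; auto simp: ns2_coord_simps field_simps; fail)+

lemma coord_lower_GP_minus_1:
  "lin_ext lower_GP_minus_1 y \<bullet> GM j = (1 - of_int j) / 4 * (y \<bullet> LL j) - (y \<bullet> II j) / 2"
  "lin_ext lower_GP_minus_1 y \<bullet> LL n = - (y \<bullet> GP (n - 1))"
  "lin_ext lower_GP_minus_1 y \<bullet> II n = (of_int n - 1) / 2 * (y \<bullet> GP (n - 1))"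
  "lin_ext lower_GP_minus_1 y \<bullet> GP n = 0"
  "lin_ext lower_GP_minus_1 y \<bullet> CC = 0"
  by (subst coord_lin_ext_ns2[of "{LL j, II j}"] coord_lin_ext_ns2[of "{GP (n - 1)}"]
      coord_lin_ext_ns2[of "{}"]; auto simp: ns2_coord_simps field_simps; fail)+

text \<open>
  The homology of each of the two differentials on the algebra is spanned by the central vector.  So the
  partial derivative on the first leg suffices except next to a central first leg, where it has to act
  on the second leg.
\<close>

definition homotopy :: "(ns2_basis \<Rightarrow> ns2_basis cvec)
    \<Rightarrow> (ns2_basis \<times> ns2_basis) cvec \<Rightarrow> (ns2_basis \<times> ns2_basis) cvec"
  where "homotopy h = slots h (\<lambda>a. if a = CC then h else (\<lambda>_. 0))"

lemma lin_ext_zero_fun [simp]: "lin_ext (\<lambda>_. 0) x = 0"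
  by (simp add: lin_ext_def)

lemma coord_homotopy: "homotopy h v \<bullet> (p, q)
    = lin_ext h (col q v) \<bullet> p + (if p = CC then lin_ext h (row p v) \<bullet> q else 0)"
  by (simp add: homotopy_def lookup_slots)

text \<open>
  The super Jacobi identity and skew-symmetry of \<open>ns2_br\<close> are carried as hypotheses: they are part of
  the given bialgebra structure.
\<close>

locale ns2_algebra = lie_superalgebra ns2_par ns2_br
begin

abbreviation act :: "ns2_basis \<Rightarrow> (ns2_basis \<times> ns2_basis) cvec \<Rightarrow> (ns2_basis \<times> ns2_basis) cvec"
  where "act x \<equiv> adj_act ns2_par ns2_br (bvec x)"

text \<open>
  The differential \<open>GP 0\<close> is exact away from \<open>(CC, CC)\<close>.
\<close>

lemma homotopy_GP_0:
  "act (GP 0) (homotopy lower_GP_0 v) + homotopy lower_GP_0 (act (GP 0) v)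
    = v - (v \<bullet> (CC, CC)) \<cdot> bvec (CC, CC)"
proof (rule poly_mapping_eqI)
  fix pq
  show "(act (GP 0) (homotopy lower_GP_0 v) + homotopy lower_GP_0 (act (GP 0) v)) \<bullet> pq
    = (v - (v \<bullet> (CC, CC)) \<cdot> bvec (CC, CC)) \<bullet> pq"
  proof (cases pq)
    case (Pair p q)
    show ?thesis unfolding Pair
      by (cases p; cases q)
        (simp_all add: lookup_add lookup_minus single_simps lookup_adj_act coord_homotopy
          coord_br_GP coord_lower_GP_0 field_simps)
  qed
qed

lemma homotopy_GP_minus_1:
  "act (GP (- 1)) (homotopy lower_GP_minus_1 v) + homotopy lower_GP_minus_1 (act (GP (- 1)) v)
    = v - (v \<bullet> (CC, CC)) \<cdot> bvec (CC, CC)"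
proof (rule poly_mapping_eqI)
  fix pq
  show "(act (GP (- 1)) (homotopy lower_GP_minus_1 v) + homotopy lower_GP_minus_1 (act (GP (- 1)) v)) \<bullet> pq
    = (v - (v \<bullet> (CC, CC)) \<cdot> bvec (CC, CC)) \<bullet> pq"
  proof (cases pq)
    case (Pair p q)
    show ?thesis unfolding Pair
      by (cases p; cases q)
        (simp_all add: lookup_add lookup_minus single_simps lookup_adj_act coord_homotopy
          coord_br_GP coord_lower_GP_minus_1 field_simps)
  qed
qed

text \<open>
  Applying the homotopy of \<open>GP (- 1)\<close> does not leave the kernel of \<open>GP 0\<close>, so the two can be
  trivialised one after the other.
\<close>

lemma homotopy_anticommutes:
  "act (GP 0) (homotopy lower_GP_minus_1 v) + homotopy lower_GP_minus_1 (act (GP 0) v) = 0"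
proof (rule poly_mapping_eqI)
  fix pq
  show "(act (GP 0) (homotopy lower_GP_minus_1 v) + homotopy lower_GP_minus_1 (act (GP 0) v)) \<bullet> pq = 0 \<bullet> pq"
  proof (cases pq)
    case (Pair p q)
    show ?thesis unfolding Pair
      by (cases p; cases q)
        (simp_all add: lookup_add lookup_minus single_simps lookup_adj_act coord_homotopy
          coord_br_GP coord_lower_GP_minus_1 field_simps)
  qed
qed

end

section \<open>Laurent polynomials in two variables, by coefficients\<close>

text \<open>
  In terms of generating functions: multiplication by $x - y$ is injective on Laurent polynomials.
\<close>

lemma antidiagonal_constant_zero:
  fixes f :: "int \<Rightarrow> int \<Rightarrow> complex"
  assumes step: "\<And>c b. f (c + 1) b = f c (b + 1)" and bound: "\<And>c b. N < c \<Longrightarrow> f c b = 0"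
  shows "f c b = 0"
proof -
  have "f (c + int n) (b - int n) = f c b" for n
  proof (induction n)
    case (Suc n)
    have "f (c + int (Suc n)) (b - int (Suc n)) = f (c + int n + 1) (b - int n - 1)"
      by (simp add: algebra_simps)
    also have "\<dots> = f (c + int n) (b - int n)"
      by (subst step) simp
    finally show ?case using Suc by simp
  qed simp
  from this[of "nat (N - c + 1)"] bound[of "c + int (nat (N - c + 1))"]
  show ?thesis by (cases "c \<le> N") (auto simp: bound)
qed

text \<open>
  The coefficient form of $h = (x - y) K$.
\<close>

definition diagonal_difference :: "(int \<times> int) cvec \<Rightarrow> (int \<times> int) cvec \<Rightarrow> bool"
  where "diagonal_difference h K \<longleftrightarrow> (\<forall>c b. h \<bullet> (c, b) = K \<bullet> (c - 1, b) - K \<bullet> (c, b - 1))"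

definition flip :: "(int \<times> int) cvec \<Rightarrow> (int \<times> int) cvec"
  where "flip = lin_ext (\<lambda>(a, b). bvec (b, a))"

lemma coord_flip [simp]: "flip h \<bullet> (a, b) = h \<bullet> (b, a)"
  unfolding flip_def
  by (subst lookup_lin_ext[of "{(b, a)}"]) (auto simp: single_simps split: if_splits)

lemma diagonal_difference_add:
  "diagonal_difference h K \<Longrightarrow> diagonal_difference h' K' \<Longrightarrow> diagonal_difference (h + h') (K + K')"
  by (simp add: diagonal_difference_def lookup_add)

lemma diagonal_difference_smul:
  "diagonal_difference h K \<Longrightarrow> diagonal_difference (c \<cdot> h) (c \<cdot> K)"
  by (simp add: diagonal_difference_def right_diff_distrib)

text \<open>
  Modulo multiples of $x - y$, a monomial may be moved step by step along its antidiagonal.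
\<close>

lemma diagonal_difference_walk:
  "\<exists>K. diagonal_difference (bvec (i + int n, j) - bvec (i, j + int n)) K"
proof (induction n arbitrary: j)
  case 0
  have "diagonal_difference (bvec (i + int 0, j) - bvec (i, j + int 0)) 0"
    by (simp add: diagonal_difference_def)
  then show ?case by blast
next
  case (Suc n)
  obtain K where K: "diagonal_difference (bvec (i + int n, j + 1) - bvec (i, j + 1 + int n)) K"
    using Suc by blast
  have "diagonal_difference (bvec (i + int n + 1, j) - bvec (i + int n, j + 1)) (bvec (i + int n, j))"
    by (auto simp: diagonal_difference_def lookup_minus single_simps)
  from diagonal_difference_add[OF this K] show ?case
    by (auto simp: algebra_simps)
qed

lemma diagonal_difference_flip: "\<exists>K. diagonal_difference (h - flip h) K"
proof (induction h rule: cvec_induct)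
  case zero
  have "diagonal_difference (0 - flip 0) 0" by (simp add: diagonal_difference_def lookup_minus)
  then show ?case by blast
next
  case (add x y)
  then obtain K K' where "diagonal_difference (x - flip x) K" "diagonal_difference (y - flip y) K'"
    by blast
  from diagonal_difference_add[OF this] show ?case
    by (auto simp: flip_def lin_ext_add algebra_simps)
next
  case (basis c ij)
  obtain i j where ij: "ij = (i, j)" by (cases ij)
  have "\<exists>K. diagonal_difference (bvec (i, j) - bvec (j, i)) K"
  proof (cases "j \<le> i")
    case True
    then show ?thesis using diagonal_difference_walk[of j "nat (i - j)" j] by simp
  next
    case False
    then obtain K where "diagonal_difference (bvec (j, i) - bvec (i, j)) K"
      using diagonal_difference_walk[of i "nat (j - i)" i] by auto
    from diagonal_difference_smul[OF this, of "-1"] show ?thesis by auto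
  qed
  then obtain K where "diagonal_difference (bvec (i, j) - bvec (j, i)) K" by blast
  from diagonal_difference_smul[OF this, of c] show ?case
    by (auto simp: ij flip_def lin_ext_smul cvec.scale_right_diff_distrib)
qed

text \<open>
  An antisymmetric Laurent polynomial vanishes on the diagonal and is therefore divisible by $x - y$,
  with a symmetric quotient.
\<close>

lemma antisymmetric_diagonal_difference:
  assumes "\<And>a b. h \<bullet> (a, b) = - (h \<bullet> (b, a))"
  shows "\<exists>K. diagonal_difference h K \<and> (\<forall>a b. K \<bullet> (a, b) = K \<bullet> (b, a))"
proof -
  obtain K where K: "diagonal_difference (h - flip h) K"
    using diagonal_difference_flip by blast
  \<comment> \<open>one factor $1/2$ comes from $h = (h - \mathit{flip}\,h)/2$, the other from averaging \<open>K\<close>\<close>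
  have "diagonal_difference h ((1 / 4) \<cdot> (K + flip K))"
    unfolding diagonal_difference_def
  proof (intro allI)
    fix c b
    have "h \<bullet> (c, b) - h \<bullet> (b, c) = K \<bullet> (c - 1, b) - K \<bullet> (c, b - 1)"
      "h \<bullet> (b, c) - h \<bullet> (c, b) = K \<bullet> (b - 1, c) - K \<bullet> (b, c - 1)"
      using K by (simp_all add: diagonal_difference_def lookup_minus)
    then have 1: "K \<bullet> (c - 1, b) - K \<bullet> (c, b - 1) = 2 * (h \<bullet> (c, b))"
      and 2: "K \<bullet> (b - 1, c) - K \<bullet> (b, c - 1) = - 2 * (h \<bullet> (c, b))"
      using assms[of b c] by simp_all
    have "((1 / 4) \<cdot> (K + flip K)) \<bullet> (c - 1, b) - ((1 / 4) \<cdot> (K + flip K)) \<bullet> (c, b - 1)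
      = ((K \<bullet> (c - 1, b) - K \<bullet> (c, b - 1)) - (K \<bullet> (b - 1, c) - K \<bullet> (b, c - 1))) / 4"
      by (simp add: lookup_add field_simps)
    then show "h \<bullet> (c, b) = ((1 / 4) \<cdot> (K + flip K)) \<bullet> (c - 1, b)
        - ((1 / 4) \<cdot> (K + flip K)) \<bullet> (c, b - 1)"
      by (simp only: 1 2) simp
  qed
  then show ?thesis by (intro exI[of _ "(1 / 4) \<cdot> (K + flip K)"]) (simp add: lookup_add)
qed

lemma ex_cvec_lattice:
  assumes "\<And>c b. \<bar>c\<bar> > N \<or> \<bar>b\<bar> > N \<Longrightarrow> f c b = (0 :: complex)"
  shows "\<exists>h. \<forall>c b. h \<bullet> (c :: int, b :: int) = f c b"
proof -
  have "{p. (case p of (c, b) \<Rightarrow> f c b) \<noteq> 0} \<subseteq> {- N..N} \<times> {- N..N}"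
  proof
    fix p assume p: "p \<in> {p. (case p of (c, b) \<Rightarrow> f c b) \<noteq> 0}"
    obtain c b where cb: "p = (c, b)" by (cases p)
    with p have "\<not> (\<bar>c\<bar> > N \<or> \<bar>b\<bar> > N)" using assms[of c b] by auto
    then show "p \<in> {- N..N} \<times> {- N..N}" by (auto simp: cb)
  qed
  then have "finite {p. (case p of (c, b) \<Rightarrow> f c b) \<noteq> 0}"
    by (rule finite_subset) auto
  then show ?thesis
    by (intro exI[of _ "Abs_poly_mapping (\<lambda>(c, b). f c b)"]) (simp add: lookup_Abs_poly_mapping)
qed

section \<open>Rigidity under the odd elements $G^+_p$\<close>

fun mode :: "ns2_basis \<Rightarrow> int" where
  "mode (LL n) = n" | "mode (II n) = n" | "mode (GP n) = n" | "mode (GM n) = n" | "mode CC = 0"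

lemma support_bound: "\<exists>N. \<forall>k. f k > N \<longrightarrow> (v :: 'a cvec) \<bullet> k = 0" for f :: "'a \<Rightarrow> int"
proof -
  have "f k \<le> Max (insert 0 (f ` Poly_Mapping.keys v))" if "v \<bullet> k \<noteq> 0" for k
    by (intro Max_ge) (use that in \<open>auto simp: in_keys_iff\<close>)
  then show ?thesis by (meson not_less)
qed

lemma mode_bound:
  "\<exists>N. \<forall>p q. \<bar>mode p\<bar> > N \<or> \<bar>mode q\<bar> > N \<longrightarrow> (v :: (ns2_basis \<times> ns2_basis) cvec) \<bullet> (p, q) = 0"
proof -
  obtain N where N: "\<And>pq. \<bar>mode (fst pq)\<bar> + \<bar>mode (snd pq)\<bar> > N \<Longrightarrow> v \<bullet> pq = 0"
    using support_bound[of "\<lambda>pq. \<bar>mode (fst pq)\<bar> + \<bar>mode (snd pq)\<bar>" v] by blast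
  have "v \<bullet> (p, q) = 0" if "\<bar>mode p\<bar> > N \<or> \<bar>mode q\<bar> > N" for p q
    by (rule N) (use that in auto)
  then show ?thesis by blast
qed

text \<open>
  A tensor with a central vector in every term.  These tensors form a submodule, and much of what
  follows is computed modulo it.
\<close>

definition central :: "(ns2_basis \<times> ns2_basis) cvec \<Rightarrow> bool"
  where "central v \<longleftrightarrow> (\<forall>p q. p \<noteq> CC \<longrightarrow> q \<noteq> CC \<longrightarrow> v \<bullet> (p, q) = 0)"

abbreviation even_tensor where "even_tensor v \<equiv> v \<in> homog (tensor_par ns2_par) 0"
abbreviation odd_tensor where "odd_tensor v \<equiv> v \<in> homog (tensor_par ns2_par) 1"
abbreviation "ns2_skew \<equiv> skew ns2_par"

lemma odd_coord:
  assumes "odd_tensor v" "ns2_par p = ns2_par q"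
  shows "v \<bullet> (p, q) = 0"
  using assms(1)[unfolded homog_iff_lookup, rule_format, of "(p, q)"] assms(2)
  by (cases "ns2_par q" rule: bit_exhaust) auto

lemma even_coord:
  assumes "even_tensor v" "ns2_par p \<noteq> ns2_par q"
  shows "v \<bullet> (p, q) = 0"
  using assms(1)[unfolded homog_iff_lookup, rule_format, of "(p, q)"] assms(2)
  by (cases "ns2_par q" rule: bit_exhaust; cases "ns2_par p" rule: bit_exhaust) auto

lemma skew_coord:
  assumes "ns2_skew v"
  shows "v \<bullet> (p, q) = - (ksign (ns2_par p * ns2_par q) * v \<bullet> (q, p))"
  using assms unfolding skew_lookup by blast

lemma skew_coord_CC: "ns2_skew v \<Longrightarrow> v \<bullet> (CC, CC) = 0"
  using skew_coord[of v CC CC] by simp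

lemma odd_skew_central:
  assumes "odd_tensor v" "ns2_skew v"
    and "\<And>c b. v \<bullet> (LL c, GP b) = 0" "\<And>c b. v \<bullet> (II c, GP b) = 0"
    and "\<And>c b. v \<bullet> (LL c, GM b) = 0" "\<And>c b. v \<bullet> (II c, GM b) = 0"
  shows "central v"
  unfolding central_def
proof (intro allI impI)
  fix p q assume "p \<noteq> CC" "q \<noteq> CC"
  then show "v \<bullet> (p, q) = 0"
    by (cases p; cases q)
      (simp_all add: odd_coord[OF assms(1)] assms(3-) skew_coord[OF assms(2), of "GP _" "LL _"]
        skew_coord[OF assms(2), of "GP _" "II _"] skew_coord[OF assms(2), of "GM _" "LL _"]
        skew_coord[OF assms(2), of "GM _" "II _"])
qed

lemma central_skew_zero:
  assumes "central v" "ns2_skew v" "\<And>q. v \<bullet> (CC, q) = 0"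
  shows "v = 0"
proof (rule poly_mapping_eqI)
  fix pq :: "ns2_basis \<times> ns2_basis"
  obtain p q where pq: "pq = (p, q)" by (cases pq)
  have "v \<bullet> (p, CC) = 0"
    using skew_coord[OF assms(2), of p CC] assms(3)[of p] by simp
  then show "v \<bullet> pq = 0 \<bullet> pq"
    using assms(1) assms(3)[of q] by (cases "p = CC"; cases "q = CC") (simp_all add: central_def pq)
qed

lemma central_closed:
  "central 0" "central v \<Longrightarrow> central w \<Longrightarrow> central (v + w)"
  "central v \<Longrightarrow> central w \<Longrightarrow> central (v - w)" "central v \<Longrightarrow> central (- v)"
  "central v \<Longrightarrow> central (c \<cdot> v)"
  by (simp_all add: central_def lookup_add lookup_minus)

lemma eq_uminus_self:
  assumes "x = - x"
  shows "(x :: 'a cvec) = 0"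
proof (rule poly_mapping_eqI)
  fix k
  have "x \<bullet> k = - (x \<bullet> k)" by (subst assms) simp
  then show "x \<bullet> k = 0 \<bullet> k" by simp
qed

context ns2_algebra
begin

lemma act_GG: "act (GP s) (act (GP t) v) = - act (GP t) (act (GP s) v)"
  using adj_act_br[of "GP s" "GP t" v] by (simp add: ns2_br_bvec adj_act_simps eq_neg_iff_add_eq_0)

lemma act_G_square: "act (GP s) (act (GP s) v) = 0"
  by (rule eq_uminus_self) (rule act_GG)

lemma ns2_br_central_vector: "(\<And>a. a \<noteq> CC \<Longrightarrow> y \<bullet> a = 0) \<Longrightarrow> ns2_br (bvec x) y = 0"
proof -
  assume "\<And>a. a \<noteq> CC \<Longrightarrow> y \<bullet> a = 0"
  then have y: "y = (y \<bullet> CC) \<cdot> bvec CC"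
    by (intro poly_mapping_eqI) (auto simp: single_simps)
  have "ns2_br_basis x CC = 0" by (cases x) auto
  then show ?thesis by (subst y) (simp add: br_simps ns2_br_bvec)
qed

text \<open>
  On the tensors $C \otimes d - d \otimes C$ the algebra acts through $d$.
\<close>

lemma coord_act_central:
  assumes "central v" "q \<noteq> CC"
  shows "act x v \<bullet> (CC, q) = ns2_br (bvec x) (row CC v) \<bullet> q"
proof -
  have "ns2_br (bvec x) (col q v) = 0"
    by (rule ns2_br_central_vector) (use assms in \<open>simp add: central_def\<close>)
  then show ?thesis by (simp add: lookup_adj_act)
qed

lemma central_act: "central v \<Longrightarrow> central (act x v)"
  unfolding central_def
proof (intro allI impI)
  fix p q assume v: "\<forall>p q. p \<noteq> CC \<longrightarrow> q \<noteq> CC \<longrightarrow> v \<bullet> (p, q) = 0" and pq: "p \<noteq> CC" "q \<noteq> CC"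
  have "ns2_br (bvec x) (col q v) = 0" "ns2_br (bvec x) (row p v) = 0"
    by (rule ns2_br_central_vector; use v pq in simp)+
  then show "act x v \<bullet> (p, q) = 0" by (simp add: lookup_adj_act)
qed

lemma coord_act_GP_GP_GP:
  assumes "ns2_skew v" "odd_tensor v"
  shows "act (GP k) v \<bullet> (GP c, GP b)
    = (3 * of_int k + 1 - of_int c) / 2 * (v \<bullet> (LL (c - k), GP b)) - v \<bullet> (II (c - k), GP b)
    + (3 * of_int k + 1 - of_int b) / 2 * (v \<bullet> (LL (b - k), GP c)) - v \<bullet> (II (b - k), GP c)"
  by (simp add: lookup_adj_act coord_br_GP skew_coord[OF assms(1), of "GP c" "LL _"]
      skew_coord[OF assms(1), of "GP c" "II _"])

text \<open>
  On the part of $v$ with one leg in the span of the \<open>GM\<close>, only the other leg contributes to the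
  coordinates below, and there \<open>GP 0\<close> and \<open>GP (- 1)\<close> give two independent equations for each pair
  of coefficients.
\<close>

lemma odd_minus_part_zero:
  assumes odd: "odd_tensor v" and skew: "ns2_skew v"
    and "\<And>k. k \<in> {-1, 0} \<Longrightarrow> central (act (GP k) v)"
  shows "v \<bullet> (LL c, GM b) = 0" "v \<bullet> (II c, GM b) = 0"
proof -
  \<comment> \<open>the mode shift of \<open>GP (- 1)\<close> makes its coordinate \<open>c - 1\<close> involve the same coefficients as the
    coordinate \<open>c\<close> of \<open>GP 0\<close>\<close>
  have "act (GP 0) v \<bullet> (GP c, GM b) = 0" "act (GP (- 1)) v \<bullet> (GP (c - 1), GM b) = 0"
    using assms(3)[of 0] assms(3)[of "-1"] by (simp_all add: central_def)
  then have 1: "(1 - of_int c) / 2 * (v \<bullet> (LL c, GM b)) = v \<bullet> (II c, GM b)"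
    and 2: "(- 1 - of_int c) / 2 * (v \<bullet> (LL c, GM b)) = v \<bullet> (II c, GM b)"
    by (simp_all add: lookup_adj_act coord_br_GP)
  from 1 2 show "v \<bullet> (LL c, GM b) = 0" by (simp add: field_simps)
  with 1 show "v \<bullet> (II c, GM b) = 0" by simp
qed

text \<open>
  Let $a$ and $F$ be the Laurent polynomials with coefficients \<open>v \<bullet> (LL c, GP b)\<close> and
  \<open>(1 - c) / 2 * a c b - v \<bullet> (II c, GP b)\<close>.  Annihilation by \<open>GP k\<close>, up to central terms,
  means that $x^k (k a + F)$ is
  antisymmetric.  The values $k = 0, -1, 1$ give $a = \frac12 (x - y) h$ and $F = -\frac12 (x + y) h$ with a
  single antisymmetric $h$.
\<close>

lemma odd_structure:
  assumes odd: "odd_tensor v" and skew: "ns2_skew v"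
    and "\<And>k. k \<in> {-1, 0, 1} \<Longrightarrow> central (act (GP k) v)"
  obtains h N where "\<And>c b. h c b = - h b c"
    and "\<And>c b. \<bar>c\<bar> > N \<or> \<bar>b\<bar> > N \<Longrightarrow> h c b = 0"
    and "\<And>c b. v \<bullet> (LL c, GP b) = (h (c - 1) b - h c (b - 1)) / 2"
    and "\<And>c b. v \<bullet> (II c, GP b) = (1 - of_int c) / 2 * (v \<bullet> (LL c, GP b))
      + (h (c - 1) b + h c (b - 1)) / 2"
proof -
  define a where "a c b = v \<bullet> (LL c, GP b)" for c b
  define F where "F c b = (1 - of_int c) / 2 * a c b - v \<bullet> (II c, GP b)" for c b
  obtain N where N: "\<And>p q. \<bar>mode p\<bar> > N \<or> \<bar>mode q\<bar> > N \<Longrightarrow> v \<bullet> (p, q) = 0"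
    using mode_bound[of v] by blast
  have aN: "a c b = 0" and FN: "F c b = 0" if "\<bar>c\<bar> > N \<or> \<bar>b\<bar> > N" for c b
    using N[of "LL c" "GP b"] N[of "II c" "GP b"] that by (simp_all add: a_def F_def)
  have aF: "a c b = 0" "F c b = 0" if "\<bar>N\<bar> < c" for c b
    by (rule aN FN; use that in auto)+
  have II: "v \<bullet> (II c, GP b) = (1 - of_int c) / 2 * a c b - F c b" for c b
    by (simp add: F_def)
  have eq: "of_int k * a (c - k) b + F (c - k) b + (of_int k * a (b - k) c + F (b - k) c) = 0"
    if "k \<in> {-1, 0, 1}" for k c b
  proof -
    have "act (GP k) v \<bullet> (GP c, GP b)
        = of_int k * a (c - k) b + F (c - k) b + (of_int k * a (b - k) c + F (b - k) c)"
      unfolding coord_act_GP_GP_GP[OF skew odd] II a_def[symmetric] by (simp add: field_simps)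
    then show ?thesis
      using assms(3)[OF that] by (simp add: central_def)
  qed
  \<comment> \<open>the coefficients of $x^{-1}(a - F)$ and of $x (a + F)$, antisymmetric by the cases $k = -1$ and
    $k = 1$; the case $k = 0$ then forces $j = - x y h$\<close>
  define h where "h c b = a (c + 1) b - F (c + 1) b" for c b
  define j where "j c b = a (c - 1) b + F (c - 1) b" for c b
  have F_anti: "F c b = - F b c" for c b
    using eq[of 0 c b] by (simp add: eq_neg_iff_add_eq_0)
  have h_anti: "h c b = - h b c" for c b
    using eq[of "-1" c b] by (simp add: h_def algebra_simps eq_neg_iff_add_eq_0)
  have j_anti: "j c b = - j b c" for c b
    unfolding eq_neg_iff_add_eq_0 using eq[of 1 c b] by (simp add: j_def)
  have jh: "j c b + h (c - 1) (b - 1) = 0" for c b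
  proof (rule antidiagonal_constant_zero[where f = "\<lambda>c b. j c b + h (c - 1) (b - 1)"])
    fix c b
    have j: "j (c + 1) b = 2 * F c b + h (c - 1) b" for c b
      by (simp add: j_def h_def)
    have "j c (b + 1) = - (2 * F b c + h (b - 1) c)"
      by (subst j_anti) (simp add: j)
    also have "\<dots> = 2 * F c b + h c (b - 1)"
      using F_anti[of b c] h_anti[of "b - 1" c] by simp
    finally show "j (c + 1) b + h (c + 1 - 1) (b - 1) = j c (b + 1) + h (c - 1) (b + 1 - 1)"
      by (simp add: j)
  next
    fix c b assume "\<bar>N\<bar> + 1 < c"
    then show "j c b + h (c - 1) (b - 1) = 0" by (simp add: j_def h_def aF)
  qed
  have j: "j (c + 1) b = - h c (b - 1)" for c b
    using jh[of "c + 1" b] by (simp add: eq_neg_iff_add_eq_0)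
  show thesis
  proof
    show "h c b = - h b c" for c b by (rule h_anti)
    show "h c b = 0" if "\<bar>c\<bar> > N + 1 \<or> \<bar>b\<bar> > N + 1" for c b
    proof -
      have "\<bar>c + 1\<bar> > N \<or> \<bar>b\<bar> > N" using that by arith
      then show ?thesis by (simp add: h_def aN FN)
    qed
    have minus: "a c b - F c b = h (c - 1) b" and plus: "a c b + F c b = - h c (b - 1)" for c b
      using j[of c b] by (simp_all add: h_def j_def)
    have "v \<bullet> (LL c, GP b) = ((a c b - F c b) + (a c b + F c b)) / 2" for c b
      by (simp add: a_def)
    then show "v \<bullet> (LL c, GP b) = (h (c - 1) b - h c (b - 1)) / 2" for c b
      unfolding minus plus by simp
    have "F c b = ((a c b + F c b) - (a c b - F c b)) / 2" for c b
      by simp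
    then have "F c b = - (h (c - 1) b + h c (b - 1)) / 2" for c b
      unfolding minus plus by (metis (no_types) add_uminus_conv_diff minus_add_distrib add.commute)
    then show "v \<bullet> (II c, GP b) = (1 - of_int c) / 2 * (v \<bullet> (LL c, GP b))
      + (h (c - 1) b + h c (b - 1)) / 2" for c b
      unfolding II a_def by simp
  qed
qed

text \<open>
  In the notation of the previous lemma, the condition for $k = 2$ reads $(x - y)^3 h = 0$.
\<close>

lemma odd_rigid:
  assumes odd: "odd_tensor v" and skew: "ns2_skew v"
    and kill: "\<And>k. k \<in> {-1, 0, 1, 2} \<Longrightarrow> central (act (GP k) v)"
  shows "central v"
proof -
  have kill3: "\<And>k. k \<in> {-1, 0, 1} \<Longrightarrow> central (act (GP k) v)"
    using kill by auto
  obtain h N where anti: "\<And>c b. h c b = - h b c"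
    and N: "\<And>c b. \<bar>c\<bar> > N \<or> \<bar>b\<bar> > N \<Longrightarrow> h c b = 0"
    and a: "\<And>c b. v \<bullet> (LL c, GP b) = (h (c - 1) b - h c (b - 1)) / 2"
    and i: "\<And>c b. v \<bullet> (II c, GP b) = (1 - of_int c) / 2 * (v \<bullet> (LL c, GP b))
      + (h (c - 1) b + h c (b - 1)) / 2"
    by (rule odd_structure[OF odd skew kill3], assumption, rule that, assumption+)
  have kill2: "\<And>k. k \<in> {-1, 0} \<Longrightarrow> central (act (GP k) v)"
    using kill by auto
  have Nh: "h c b = 0" if "\<bar>N\<bar> < c" for c b
    by (rule N) (use that in auto)
  define d1 where "d1 c b = h (c + 1) b - h c (b + 1)" for c b
  define d2 where "d2 c b = d1 (c + 1) b - d1 c (b + 1)" for c b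
  have third: "h (c - 3) b - 3 * h (c - 2) (b - 1) + 3 * h (c - 1) (b - 2) - h c (b - 3) = 0" for c b
  proof -
    have "act (GP 2) v \<bullet> (GP c, GP b) = 0"
      using kill[of 2] by (simp add: central_def)
    moreover have "act (GP 2) v \<bullet> (GP c, GP b)
      = (h (c - 3) b - 3 * h (c - 2) (b - 1) + 3 * h (c - 1) (b - 2) - h c (b - 3)) / 2"
      unfolding coord_act_GP_GP_GP[OF skew odd] i a
      using anti[of "b - 3" c] anti[of "b - 2" "c - 1"]
      by (simp add: field_simps)
    ultimately show ?thesis by simp
  qed
  have "d2 (c + 1) b = d2 c (b + 1)" for c b
    using third[of "c + 3" "b + 3"] by (simp add: d2_def d1_def algebra_simps)
  then have "d2 c b = 0" for c b
    by (rule antidiagonal_constant_zero[where N = "\<bar>N\<bar>"]) (simp add: d1_def d2_def Nh)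
  then have "d1 (c + 1) b = d1 c (b + 1)" for c b
    by (simp add: d2_def)
  then have "d1 c b = 0" for c b
    by (rule antidiagonal_constant_zero[where N = "\<bar>N\<bar>"]) (simp add: d1_def Nh)
  then have "h (c + 1) b = h c (b + 1)" for c b
    by (simp add: d1_def)
  then have "h c b = 0" for c b
    by (rule antidiagonal_constant_zero[where N = "\<bar>N\<bar>"]) (simp add: Nh)
  then have "v \<bullet> (LL c, GP b) = 0" "v \<bullet> (II c, GP b) = 0" for c b
    by (simp_all add: a i)
  then show ?thesis
    by (intro odd_skew_central odd skew odd_minus_part_zero[OF odd skew kill2])
qed

text \<open>
  A coordinate equation of \<open>act (GP k) v\<close> combines coefficients at positions that do not move with
  $k$, entering affinely in $k$, and one coefficient at a position that leaves every finite set as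
  $k$ grows.  For large $k$ the latter is zero, and two such values of $k$ determine the affine part.
\<close>

lemma even_structure:
  assumes even: "even_tensor v" and skew: "ns2_skew v"
    and kill: "\<And>k. central (act (GP k) v)"
    and pq: "p \<noteq> CC" "q \<noteq> CC" "\<not> (\<exists>a b. p = GP a \<and> q = GP b)"
  shows "v \<bullet> (p, q) = 0"
proof -
  obtain N where N: "\<And>p q. \<bar>mode p\<bar> > N \<or> \<bar>mode q\<bar> > N \<Longrightarrow> v \<bullet> (p, q) = 0"
    using mode_bound[of v] by blast
  have z: "act (GP k) v \<bullet> (p, q) = 0" if "p \<noteq> CC" "q \<noteq> CC" for k p q
    using kill[of k] that by (simp add: central_def)
  have MM: "v \<bullet> (GM j, GM b) = 0" for j b
    using z[of "LL (j + 1)" "GM b" 0] by (simp add: lookup_adj_act coord_br_GP)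
  have two: "x = 0 \<and> y = 0"
    if "\<And>k :: int. k > N + \<bar>c\<bar> \<Longrightarrow> (2 * of_int k + 1 - of_int c) / 2 * x - y = 0"
    for c and x y :: complex
  proof -
    define k where "k = N + \<bar>c\<bar> + 1"
    have 1: "(2 * of_int k + 1 - of_int c) / 2 * x - y = 0"
      and 2: "(2 * of_int (k + 1) + 1 - of_int c) / 2 * x - y = 0"
      by (rule that; simp add: k_def)+
    have "x = ((2 * of_int (k + 1) + 1 - of_int c) / 2 * x - y)
        - ((2 * of_int k + 1 - of_int c) / 2 * x - y)"
      by (simp add: field_simps)
    with 1 2 have "x = 0" by simp
    with 1 show ?thesis by simp
  qed
  have L: "2 * (v \<bullet> (GM (n - k - 1), GP (c + k)))
      + ((2 * of_int k + 1 - of_int c) / 2 * (v \<bullet> (LL n, LL c)) - v \<bullet> (LL n, II c)) = 0" for n c k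
    using z[of "LL n" "GP (c + k)" k] by (simp add: lookup_adj_act coord_br_GP field_simps)
  have LL: "v \<bullet> (LL n, LL c) = 0 \<and> v \<bullet> (LL n, II c) = 0" for n c
  proof (rule two[of c])
    fix k assume "k > N + \<bar>c\<bar>"
    then have "v \<bullet> (GM (n - k - 1), GP (c + k)) = 0" by (intro N) auto
    with L[of n k c]
    show "(2 * of_int k + 1 - of_int c) / 2 * (v \<bullet> (LL n, LL c)) - v \<bullet> (LL n, II c) = 0" by simp
  qed
  have I: "(2 * of_int k + 1 - of_int n) * (v \<bullet> (GM (n - k - 1), GP (c + k)))
      + ((2 * of_int k + 1 - of_int c) / 2 * (v \<bullet> (II n, LL c)) - v \<bullet> (II n, II c)) = 0" for n c k
    using z[of "II n" "GP (c + k)" k] by (simp add: lookup_adj_act coord_br_GP field_simps)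
  have II: "v \<bullet> (II n, LL c) = 0 \<and> v \<bullet> (II n, II c) = 0" for n c
  proof (rule two[of c])
    fix k assume "k > N + \<bar>c\<bar>"
    then have "v \<bullet> (GM (n - k - 1), GP (c + k)) = 0" by (intro N) auto
    with I[of k n c]
    show "(2 * of_int k + 1 - of_int c) / 2 * (v \<bullet> (II n, LL c)) - v \<bullet> (II n, II c) = 0" by simp
  qed
  have MP: "v \<bullet> (GM j, GP b) = 0" for j b
    using L[of "j + 1" 0 b] LL[of "j + 1" b] by simp
  have PM: "v \<bullet> (GP b, GM j) = 0" for j b
    using skew_coord[OF skew, of "GP b" "GM j"] MP[of j b] by simp
  show ?thesis using pq
    by (cases p; cases q) (simp_all add: MM LL II MP PM even_coord[OF even])
qed

text \<open>
  The elements \<open>GP 0\<close> and \<open>GP (- 1)\<close> have trivial common kernel on the span of the \<open>LL\<close> and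
  \<open>II\<close>, and no central terms.
\<close>

lemma even_CC_row_zero:
  assumes even: "even_tensor v" and skew: "ns2_skew v"
    and "act (GP 0) v = 0" "act (GP (- 1)) v = 0"
  shows "v \<bullet> (CC, q) = 0"
proof -
  have "act (GP 0) v \<bullet> (CC, GP c) = 0" "act (GP (- 1)) v \<bullet> (CC, GP (c - 1)) = 0" for c
    using assms(3,4) by simp_all
  then have 1: "(1 - of_int c) / 2 * (v \<bullet> (CC, LL c)) = v \<bullet> (CC, II c)"
    and 2: "(- 1 - of_int c) / 2 * (v \<bullet> (CC, LL c)) = v \<bullet> (CC, II c)" for c
    by (simp_all add: lookup_adj_act coord_br_GP)
  have LL: "v \<bullet> (CC, LL c) = 0" for c using 1[of c] 2[of c] by (simp add: field_simps)
  have II: "v \<bullet> (CC, II c) = 0" for c using 1[of c] LL[of c] by simp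
  show ?thesis
    by (cases q) (simp_all add: LL II even_coord[OF even] skew_coord_CC[OF skew])
qed

end

section \<open>Vanishing of the first cohomology\<close>

lemma homog_closed:
  "x \<in> homog par i \<Longrightarrow> y \<in> homog par i \<Longrightarrow> x + y \<in> homog par i"
  "x \<in> homog par i \<Longrightarrow> y \<in> homog par i \<Longrightarrow> x - y \<in> homog par i"
  "x \<in> homog par i \<Longrightarrow> c \<cdot> x \<in> homog par i"
  "0 \<in> homog par i"
  unfolding homog_iff_lookup by (auto simp: lookup_add lookup_minus) (metis add_0)+

lemma homog_super_twist: "v \<in> homog (tensor_par par) i \<Longrightarrow> super_twist par v \<in> homog (tensor_par par) i"
  unfolding homog_iff_lookup
  by (metis (no_types, lifting) add.commute lookup_super_twist mult_zero_right surj_pair tensor_par_simp)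

lemma skew_closed:
  "skew par v \<Longrightarrow> skew par w \<Longrightarrow> skew par (v + w)"
  "skew par v \<Longrightarrow> skew par w \<Longrightarrow> skew par (v - w)"
  "skew par v \<Longrightarrow> skew par (c \<cdot> v)"
  by (simp_all add: skew_def super_twist_add super_twist_diff super_twist_smul)

lemma odd_homotopy_even:
  assumes "odd_tensor v" and h: "\<And>y p. lin_ext h y \<bullet> p \<noteq> 0 \<Longrightarrow> \<exists>q. y \<bullet> q \<noteq> 0 \<and> ns2_par q = ns2_par p + 1"
  shows "even_tensor (homotopy h v)"
  unfolding homog_iff_lookup
proof (intro allI impI)
  fix pq assume nz: "homotopy h v \<bullet> pq \<noteq> 0"
  obtain p q where pq: "pq = (p, q)" by (cases pq)
  have "lin_ext h (col q v) \<bullet> p \<noteq> 0 \<or> lin_ext h (row p v) \<bullet> q \<noteq> 0"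
    using nz by (auto simp: pq coord_homotopy split: if_splits)
  then obtain p' q' where "v \<bullet> (p', q') \<noteq> 0" "ns2_par p' + ns2_par q' = ns2_par p + ns2_par q + 1"
    using h[of "col q v" p] h[of "row p v" q]
    by (auto simp del: add_bit_eq_xor simp: add_ac)
  then show "tensor_par ns2_par pq = 0"
    using odd_coord[OF assms(1), of p' q']
    by (cases "ns2_par p" rule: bit_exhaust; cases "ns2_par q" rule: bit_exhaust;
        cases "ns2_par p'" rule: bit_exhaust; cases "ns2_par q'" rule: bit_exhaust) (auto simp: pq)
qed

lemma lower_GP_0_odd: "lin_ext lower_GP_0 y \<bullet> p \<noteq> 0 \<Longrightarrow> \<exists>q. y \<bullet> q \<noteq> 0 \<and> ns2_par q = ns2_par p + 1"
proof (cases p)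
  case (GM j)
  assume "lin_ext lower_GP_0 y \<bullet> p \<noteq> 0"
  then have "y \<bullet> LL (j + 1) \<noteq> 0 \<or> y \<bullet> II (j + 1) \<noteq> 0" by (auto simp: GM coord_lower_GP_0)
  then show ?thesis using GM by (auto intro: exI[of _ "LL _"] exI[of _ "II _"])
qed (auto simp: coord_lower_GP_0 intro: exI[of _ "GP _"])

lemma lower_GP_minus_1_odd: "lin_ext lower_GP_minus_1 y \<bullet> p \<noteq> 0 \<Longrightarrow> \<exists>q. y \<bullet> q \<noteq> 0 \<and> ns2_par q = ns2_par p + 1"
proof (cases p)
  case (GM j)
  assume "lin_ext lower_GP_minus_1 y \<bullet> p \<noteq> 0"
  then have "y \<bullet> LL j \<noteq> 0 \<or> y \<bullet> II j \<noteq> 0" by (auto simp: GM coord_lower_GP_minus_1)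
  then show ?thesis using GM by (auto intro: exI[of _ "LL _"] exI[of _ "II _"])
qed (auto simp: coord_lower_GP_minus_1 intro: exI[of _ "GP _"])

definition embed_GM :: "(int \<times> int) cvec \<Rightarrow> (ns2_basis \<times> ns2_basis) cvec"
  where "embed_GM = lin_ext (\<lambda>(a, b). bvec (GM a, GM b))"

lemma coord_embed_GM:
  "embed_GM K \<bullet> (p, q) = (case (p, q) of (GM a, GM b) \<Rightarrow> K \<bullet> (a, b) | _ \<Rightarrow> 0)"
proof (cases "\<exists>a b. p = GM a \<and> q = GM b")
  case True
  then obtain a b where "p = GM a" "q = GM b" by blast
  then show ?thesis unfolding embed_GM_def
    by (subst lookup_lin_ext[of "{(a, b)}"]) (auto simp: single_simps split: if_splits)
next
  case False
  then have "embed_GM K \<bullet> (p, q) = 0" unfolding embed_GM_def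
    by (subst lookup_lin_ext[of "{}"]) (auto simp: single_simps split: if_splits)
  with False show ?thesis by (auto split: ns2_basis.split)
qed

context ns2_algebra
begin

text \<open>
  Even 1-cocycles with values in the skew tensors.  The conditions are imposed on basis vectors
  only, where parities are defined and the brackets are given by \<open>ns2_br_basis\<close>.
\<close>

definition skew_cocycle :: "(ns2_basis cvec \<Rightarrow> (ns2_basis \<times> ns2_basis) cvec) \<Rightarrow> bool" where
  "skew_cocycle D \<longleftrightarrow> clinear D
    \<and> (\<forall>x. D (bvec x) \<in> homog (tensor_par ns2_par) (ns2_par x))
    \<and> (\<forall>x. ns2_skew (D (bvec x)))
    \<and> (\<forall>x y. D (ns2_br_basis x y)
        = act x (D (bvec y)) - ksign (ns2_par x * ns2_par y) \<cdot> act y (D (bvec x)))"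

definition even_skew :: "(ns2_basis \<times> ns2_basis) cvec \<Rightarrow> bool"
  where "even_skew r \<longleftrightarrow> even_tensor r \<and> ns2_skew r"

lemma skew_cocycleD:
  assumes "skew_cocycle D"
  shows "clinear D" "D (bvec x) \<in> homog (tensor_par ns2_par) (ns2_par x)" "ns2_skew (D (bvec x))"
    "D (ns2_br_basis x y)
        = act x (D (bvec y)) - ksign (ns2_par x * ns2_par y) \<cdot> act y (D (bvec x))"
  using assms by (auto simp: skew_cocycle_def)

lemma skew_cocycle_linear:
  assumes "skew_cocycle D"
  shows "D (x + y) = D x + D y" "D (c \<cdot> x) = c \<cdot> D x" "D (- x) = - D x" "D 0 = 0"
  using clinear_add clinear_smul clinear_uminus clinear_zero skew_cocycleD(1)[OF assms] by blast+

lemma odd_D: "skew_cocycle D \<Longrightarrow> odd_tensor (D (bvec (GP k)))"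
    "skew_cocycle D \<Longrightarrow> odd_tensor (D (bvec (GM k)))"
  using skew_cocycleD(2)[of D "GP k"] skew_cocycleD(2)[of D "GM k"] by simp_all

lemma cocycle_GG:
  assumes "skew_cocycle D"
  shows "act (GP s) (D (bvec (GP t))) = - act (GP t) (D (bvec (GP s)))"
  using skew_cocycleD(4)[OF assms, of "GP s" "GP t"]
  by (simp add: skew_cocycle_linear[OF assms] eq_neg_iff_add_eq_0)

lemma skew_cocycle_diff:
  assumes D: "skew_cocycle D" and r: "even_skew r"
  shows "skew_cocycle (\<lambda>x. D x - adj_act ns2_par ns2_br x r)"
  unfolding skew_cocycle_def
proof (intro conjI allI)
  show "clinear (\<lambda>x. D x - adj_act ns2_par ns2_br x r)"
    by (intro clinearI)
      (simp_all add: skew_cocycle_linear[OF D] adj_act_simps cvec.scale_right_diff_distrib)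
  fix x y
  show "D (bvec x) - act x r \<in> homog (tensor_par ns2_par) (ns2_par x)"
    using homog_adj_act[of r 0 x] r skew_cocycleD(2)[OF D, of x]
    by (intro homog_closed) (simp_all del: add_bit_eq_xor add: even_skew_def)
  show "ns2_skew (D (bvec x) - act x r)"
    using r skew_adj_act skew_cocycleD(3)[OF D, of x] by (intro skew_closed) (auto simp: even_skew_def)
  show "D (ns2_br_basis x y) - adj_act ns2_par ns2_br (ns2_br_basis x y) r
    = act x (D (bvec y) - act y r) - ksign (ns2_par x * ns2_par y) \<cdot> act y (D (bvec x) - act x r)"
    using adj_act_br[of x y r]
    by (simp add: skew_cocycleD(4)[OF D] ns2_br_bvec adj_act_diff cvec.scale_right_diff_distrib
        algebra_simps)
qed

text \<open>
  A potential is made skew by averaging over the twist, which commutes with the action.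
\<close>

lemma skew_potential:
  assumes "even_tensor r"
  obtains r' where "even_skew r'" "\<And>x. ns2_skew (act x r) \<Longrightarrow> act x r' = act x r"
proof
  show "even_skew ((1 / 2) \<cdot> (r - super_twist ns2_par r))"
    using assms unfolding even_skew_def
    by (auto intro!: homog_closed homog_super_twist)
      (simp add: skew_def super_twist_smul super_twist_diff super_twist_twice
        cvec.scale_right_diff_distrib)
  fix x assume "ns2_skew (act x r)"
  then have "super_twist ns2_par (act x r) = - act x r" by (simp add: skew_def)
  then have "act x ((1 / 2) \<cdot> (r - super_twist ns2_par r)) = (1 / 2) \<cdot> (act x r + act x r)"
    by (simp add: adj_act_simps adj_act_diff super_twist_adj_act[symmetric])
  also have "\<dots> = act x r" by (rule poly_mapping_eqI) (simp add: lookup_add)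
  finally show "act x ((1 / 2) \<cdot> (r - super_twist ns2_par r)) = act x r" .
qed

text \<open>
  The first homotopy trivialises $D$ on \<open>GP 0\<close>.  What is left on \<open>GP (- 1)\<close> is still killed by
  \<open>GP 0\<close>, so the correction by the second homotopy leaves the value on \<open>GP 0\<close> alone.
\<close>

lemma potential_GP_half:
  assumes D: "skew_cocycle D"
  obtains r where "even_skew r" "D (bvec (GP 0)) = act (GP 0) r" "D (bvec (GP (- 1))) = act (GP (- 1)) r"
proof -
  let ?g = "act (GP 0)" and ?g' = "act (GP (- 1))"
  define D0 where "D0 = D (bvec (GP 0))"
  define r1 where "r1 = homotopy lower_GP_0 D0"
  define D1 where "D1 = D (bvec (GP (- 1))) - ?g' r1"
  define r2 where "r2 = homotopy lower_GP_minus_1 D1"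
  have odd0: "odd_tensor D0" unfolding D0_def by (rule odd_D[OF D])
  have g0: "?g D0 = 0"
    unfolding D0_def by (rule eq_uminus_self) (rule cocycle_GG[OF D])
  have h0: "homotopy h 0 = 0" for h by (simp add: homotopy_def slots_def)
  have r1: "?g r1 = D0"
    using homotopy_GP_0[of D0] odd_coord[OF odd0, of CC CC] by (simp add: r1_def g0 h0)
  have even1: "even_tensor r1"
    unfolding r1_def by (rule odd_homotopy_even[OF odd0 lower_GP_0_odd])
  have odd1: "odd_tensor D1"
    unfolding D1_def using homog_adj_act[OF even1, of "GP (- 1)"]
    by (intro homog_closed odd_D[OF D]) simp
  have "?g' (D (bvec (GP (- 1)))) = 0"
    by (rule eq_uminus_self) (rule cocycle_GG[OF D])
  then have g'1: "?g' D1 = 0" by (simp add: D1_def adj_act_diff act_G_square)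
  have g1: "?g D1 = 0"
    using cocycle_GG[OF D, of 0 "-1"] act_GG[of 0 "-1" r1]
    by (simp add: D1_def adj_act_diff r1 D0_def)
  have r2: "?g' r2 = D1"
    using homotopy_GP_minus_1[of D1] odd_coord[OF odd1, of CC CC] by (simp add: r2_def g'1 h0)
  have g2: "?g r2 = 0"
    using homotopy_anticommutes[of D1] by (simp add: r2_def g1 h0)
  have "even_tensor r2"
    unfolding r2_def by (rule odd_homotopy_even[OF odd1 lower_GP_minus_1_odd])
  with even1 have even12: "even_tensor (r1 + r2)" by (rule homog_closed)
  have 0: "?g (r1 + r2) = D (bvec (GP 0))"
    by (simp add: adj_act_simps r1 g2 D0_def)
  have 1: "?g' (r1 + r2) = D (bvec (GP (- 1)))"
    by (simp add: adj_act_simps r2) (simp add: D1_def)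
  show thesis
  proof (rule skew_potential[OF even12])
    fix r assume "even_skew r" and r: "\<And>x. ns2_skew (act x (r1 + r2)) \<Longrightarrow> act x r = act x (r1 + r2)"
    with 0 1 show thesis
      using that[of r] r[of "GP 0"] r[of "GP (- 1)"] skew_cocycleD(3)[OF D] by simp
  qed
qed

text \<open>
  The product of three differentials, applied to the tensor with Laurent polynomial $K$ on the legs
  \<open>GM\<close>, has $a = 4 (x - y)^2 K$; in the notation of \<open>odd_structure\<close>, $h = 8 (x - y) K$.
\<close>

lemma coord_triple_embed:
  assumes "\<And>a b. K \<bullet> (a, b) = K \<bullet> (b, a)"
  defines "w \<equiv> act (GP 1) (act (GP 0) (act (GP (- 1)) (embed_GM K)))"
  shows "w \<bullet> (LL n, GP b)
      = 4 * K \<bullet> (n - 2, b) + 4 * K \<bullet> (n, b - 2) - 8 * K \<bullet> (n - 1, b - 1)"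
    and "w \<bullet> (II n, GP b) = (1 - of_int n) / 2 * (w \<bullet> (LL n, GP b))
      + 4 * K \<bullet> (n - 2, b) - 4 * K \<bullet> (n, b - 2)"
proof -
  note K = assms(1)[of b "n - 2"] assms(1)[of "b - 1" "n - 1"] assms(1)[of "b - 2" n]
  show "w \<bullet> (LL n, GP b)
      = 4 * K \<bullet> (n - 2, b) + 4 * K \<bullet> (n, b - 2) - 8 * K \<bullet> (n - 1, b - 1)"
    unfolding w_def
    by (simp add: lookup_adj_act coord_br_GP coord_embed_GM K field_simps)
  then show "w \<bullet> (II n, GP b) = (1 - of_int n) / 2 * (w \<bullet> (LL n, GP b))
      + 4 * K \<bullet> (n - 2, b) - 4 * K \<bullet> (n, b - 2)"
    apply (simp only:)
    unfolding w_def
    by (simp add: lookup_adj_act coord_br_GP coord_embed_GM K field_simps)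
qed

text \<open>
  The value of $D$ on \<open>GP 1\<close> is described by an antisymmetric $h$, which is divisible by $x - y$.  The
  quotient yields a tensor in the common kernel of \<open>GP 0\<close> and \<open>GP (- 1)\<close> whose image under \<open>GP 1\<close> is this
  value, up to central terms.
\<close>

lemma potential_GP_three_halves:
  assumes D: "skew_cocycle D" and "D (bvec (GP 0)) = 0" "D (bvec (GP (- 1))) = 0"
  obtains r where "even_skew r" "act (GP 0) r = 0" "act (GP (- 1)) r = 0"
    "central (D (bvec (GP 1)) - act (GP 1) r)"
proof -
  define v where "v = D (bvec (GP 1))"
  have odd: "odd_tensor v" and skew: "ns2_skew v"
    unfolding v_def by (rule odd_D[OF D] skew_cocycleD(3)[OF D])+
  have "act (GP 1) v = 0"
    unfolding v_def by (rule eq_uminus_self) (rule cocycle_GG[OF D])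
  then have kill: "\<And>k. k \<in> {-1, 0, 1} \<Longrightarrow> central (act (GP k) v)"
    using cocycle_GG[OF D, of 0 1] cocycle_GG[OF D, of "-1" 1] assms(2,3)
    by (auto simp: v_def adj_act_simps central_closed)
  obtain h N where anti: "\<And>c b. h c b = - h b c"
    and N: "\<And>c b. \<bar>c\<bar> > N \<or> \<bar>b\<bar> > N \<Longrightarrow> h c b = 0"
    and a: "\<And>c b. v \<bullet> (LL c, GP b) = (h (c - 1) b - h c (b - 1)) / 2"
    and i: "\<And>c b. v \<bullet> (II c, GP b) = (1 - of_int c) / 2 * (v \<bullet> (LL c, GP b))
      + (h (c - 1) b + h c (b - 1)) / 2"
    by (rule odd_structure[OF odd skew kill], assumption, rule that, assumption+)
  obtain H where H: "\<And>c b. H \<bullet> (c, b) = h c b"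
    using ex_cvec_lattice[of N h] N by blast
  obtain K where "diagonal_difference H K" and K_sym: "\<And>a b. K \<bullet> (a, b) = K \<bullet> (b, a)"
    using antisymmetric_diagonal_difference[of H] anti unfolding H by blast
  then have K: "h c b = K \<bullet> (c - 1, b) - K \<bullet> (c, b - 1)" for c b
    by (simp add: diagonal_difference_def H)
  \<comment> \<open>the factor that cancels the $8$ in $h = 8 (x - y) K'$\<close>
  define K' where "K' = (1 / 8) \<cdot> K"
  have K'_sym: "K' \<bullet> (a, b) = K' \<bullet> (b, a)" for a b
    using K_sym[of a b] by (simp add: K'_def)
  define r where "r = act (GP 0) (act (GP (- 1)) (embed_GM K'))"
  have emb: "even_tensor (embed_GM K')" "ns2_skew (embed_GM K')"
  proof -
    show "even_tensor (embed_GM K')"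
      unfolding homog_iff_lookup
    proof (intro allI impI)
      fix pq assume nz: "embed_GM K' \<bullet> pq \<noteq> 0"
      obtain p q where "pq = (p, q)" by (cases pq)
      with nz show "tensor_par ns2_par pq = 0"
        by (cases p; cases q) (simp_all add: coord_embed_GM)
    qed
    have "embed_GM K' \<bullet> (p, q) = - (ksign (ns2_par p * ns2_par q) * embed_GM K' \<bullet> (q, p))" for p q
    proof (cases "\<exists>a b. p = GM a \<and> q = GM b")
      case True
      then obtain a b where "p = GM a" "q = GM b" by blast
      then show ?thesis using K'_sym[of a b] by (simp add: coord_embed_GM)
    next
      case False
      then show ?thesis by (cases p; cases q) (auto simp: coord_embed_GM)
    qed
    then show "ns2_skew (embed_GM K')" unfolding skew_lookup by blast
  qed
  have r: "even_skew r"
    using homog_adj_act[OF homog_adj_act[OF emb(1), of "GP (- 1)"], of "GP 0"]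
      skew_adj_act[OF skew_adj_act[OF emb(2), of "GP (- 1)"], of "GP 0"]
    by (simp add: even_skew_def r_def)
  have 0: "act (GP 0) r = 0"
    by (simp add: r_def act_G_square)
  have 1: "act (GP (- 1)) r = 0"
    unfolding r_def by (subst act_GG) (simp add: act_G_square adj_act_simps)
  define w where "w = act (GP 1) r"
  have w: "odd_tensor w" "ns2_skew w"
    using homog_adj_act[of r 0 "GP 1"] skew_adj_act[of r "GP 1"] r
    by (simp_all add: even_skew_def w_def)
  have kill_w: "\<And>k. k \<in> {-1, 0} \<Longrightarrow> central (act (GP k) w)"
    using act_GG[of 0 1 r] act_GG[of "-1" 1 r] by (auto simp: w_def 0 1 adj_act_simps central_closed)
  have kill_v: "\<And>k. k \<in> {-1, 0} \<Longrightarrow> central (act (GP k) v)"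
    using kill by auto
  have LL: "w \<bullet> (LL n, GP b) = v \<bullet> (LL n, GP b)" for n b
    unfolding w_def r_def coord_triple_embed[OF K'_sym] a K
    by (simp add: K'_def field_simps)
  have II: "w \<bullet> (II n, GP b) = v \<bullet> (II n, GP b)" for n b
    unfolding i LL[symmetric] K
    unfolding w_def r_def coord_triple_embed(2)[OF K'_sym]
    by (simp add: K'_def field_simps)
  have "v \<bullet> (LL c, GM b) = 0" "v \<bullet> (II c, GM b) = 0" "w \<bullet> (LL c, GM b) = 0" "w \<bullet> (II c, GM b) = 0" for c b
    by (rule odd_minus_part_zero[OF odd skew kill_v] odd_minus_part_zero[OF w kill_w]; assumption)+
  then have "central (v - w)"
    using odd skew w
    by (intro odd_skew_central homog_closed skew_closed)
      (simp_all add: lookup_minus LL II)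
  with r 0 1 show thesis by (intro that[of r]) (simp_all add: v_def w_def)
qed

end

context ns2_algebra
begin

lemma cocycle_GG_central:
  assumes D: "skew_cocycle D" and "central (D (bvec (GP s)))"
  shows "central (act (GP s) (D (bvec (GP t))))"
  by (subst cocycle_GG[OF D]) (intro central_closed central_act assms)

text \<open>
  The value on \<open>GP 2\<close> is killed by the differentials with $k = -1, 0, 1$ because $D$ is central on
  them, and by \<open>GP 2\<close> because that element squares to zero; so it is central by rigidity, and then
  the same argument applies to all other values.
\<close>

lemma odd_generators_central:
  assumes D: "skew_cocycle D" and "D (bvec (GP 0)) = 0" "D (bvec (GP (- 1))) = 0"
    and "central (D (bvec (GP 1)))"
  shows "central (D (bvec (GP t)))"
proof -
  have kill: "central (act (GP k) (D (bvec (GP t))))" if "k = -1 \<or> k = 0 \<or> k = 1" for k t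
  proof (rule cocycle_GG_central[OF D])
    show "central (D (bvec (GP k)))"
      using that assms(2-4) by (elim disjE) (simp_all add: central_closed(1))
  qed
  have "act (GP 2) (D (bvec (GP 2))) = 0"
    by (rule eq_uminus_self) (rule cocycle_GG[OF D])
  then have 2: "central (act (GP 2) (D (bvec (GP 2))))" by (simp only: central_closed(1))
  have "central (D (bvec (GP 2)))"
  proof (rule odd_rigid[OF odd_D(1)[OF D] skew_cocycleD(3)[OF D]])
    fix k :: int assume "k \<in> {-1, 0, 1, 2}"
    then show "central (act (GP k) (D (bvec (GP 2))))" using kill 2 by blast
  qed
  note 3 = cocycle_GG_central[OF D this]
  show ?thesis
  proof (rule odd_rigid[OF odd_D(1)[OF D] skew_cocycleD(3)[OF D]])
    fix k :: int assume "k \<in> {-1, 0, 1, 2}"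
    then show "central (act (GP k) (D (bvec (GP t))))" using kill 3 by blast
  qed
qed

lemma act_GP_even_central:
  assumes D: "skew_cocycle D" and P: "\<And>t. central (D (bvec (GP t)))" and x: "ns2_par x = 0"
  shows "central (act (GP t) (D (bvec x)))"
proof -
  have "central (D (ns2_br_basis (GP t) x))"
    using x by (cases x) (simp_all add: skew_cocycle_linear[OF D] central_closed P)
  moreover have "act (GP t) (D (bvec x)) = D (ns2_br_basis (GP t) x) + act x (D (bvec (GP t)))"
    using skew_cocycleD(4)[OF D, of "GP t" x] x by simp
  ultimately show ?thesis by (simp add: central_closed central_act P)
qed

text \<open>
  The value on $I_0$ lies in the span of the \<open>(GP a, GP b)\<close>.  There $I_0$ acts as the scalar $2$ and
  every \<open>GP t\<close> as zero, so half of this value is a potential that does not change the values on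
  the \<open>GP t\<close>.
\<close>

lemma potential_I0:
  assumes D: "skew_cocycle D" and "D (bvec (GP 0)) = 0" "D (bvec (GP (- 1))) = 0"
    and P: "\<And>t. central (D (bvec (GP t)))"
  obtains r where "even_skew r" "\<And>t. act (GP t) r = 0" "act (II 0) r = D (bvec (II 0))"
proof -
  define v where "v = D (bvec (II 0))"
  have even: "even_tensor v" and skew: "ns2_skew v"
    using skew_cocycleD(2)[OF D, of "II 0"] skew_cocycleD(3)[OF D] by (simp_all add: v_def)
  have kill: "central (act (GP k) v)" for k
    unfolding v_def by (rule act_GP_even_central[OF D P]) simp
  have exact: "act (GP 0) v = 0" "act (GP (- 1)) v = 0"
    using skew_cocycleD(4)[OF D, of "GP 0" "II 0"] skew_cocycleD(4)[OF D, of "GP (- 1)" "II 0"] assms(2,3)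
    by (simp_all add: v_def skew_cocycle_linear[OF D] adj_act_simps)
  have CC: "v \<bullet> (CC, q) = 0" for q
    by (rule even_CC_row_zero[OF even skew exact])
  have CC': "v \<bullet> (q, CC) = 0" for q
    using skew_coord[OF skew, of q CC] CC[of q] by simp
  have v: "v \<bullet> (p, q) = 0" if "\<not> (\<exists>a b. p = GP a \<and> q = GP b)" for p q
    using even_structure[OF even skew kill, of p q] that CC[of q] CC'[of p] by blast
  define r where "r = (1 / 2) \<cdot> v"
  have r: "r \<bullet> (p, q) = 0" if "\<not> (\<exists>a b. p = GP a \<and> q = GP b)" for p q
    using v[OF that] by (simp add: r_def)
  show thesis
  proof
    show "even_skew r"
      using even skew by (simp add: even_skew_def r_def homog_closed skew_closed)
    show "act (GP t) r = 0" for t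
    proof (rule poly_mapping_eqI)
      fix pq :: "ns2_basis \<times> ns2_basis"
      obtain p q where pq: "pq = (p, q)" by (cases pq)
      show "act (GP t) r \<bullet> pq = 0 \<bullet> pq"
        unfolding pq by (cases p; cases q) (simp_all add: lookup_adj_act coord_br_GP r)
    qed
    have "act (II 0) r = v"
    proof (rule poly_mapping_eqI)
      fix pq :: "ns2_basis \<times> ns2_basis"
      obtain p q where pq: "pq = (p, q)" by (cases pq)
      show "act (II 0) r \<bullet> pq = v \<bullet> pq"
        unfolding pq by (cases p; cases q) (simp_all add: lookup_adj_act coord_br_I0 v r_def)
    qed
    then show "act (II 0) r = D (bvec (II 0))" by (simp add: v_def)
  qed
qed

text \<open>
  Values on even elements are killed by $I_0$, which acts as $2$ on the only part left to them.  The values on the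
  \<open>GM b\<close> are then killed by all \<open>GP k\<close> up to central terms.
\<close>

lemma all_central:
  assumes D: "skew_cocycle D" and P: "\<And>t. central (D (bvec (GP t)))" and I0: "D (bvec (II 0)) = 0"
  shows "central (D (bvec x))"
proof -
  have even: "central (D (bvec x))" if x: "ns2_par x = 0" for x
  proof -
    have ev: "even_tensor (D (bvec x))" and skew: "ns2_skew (D (bvec x))"
      using skew_cocycleD(2)[OF D, of x] skew_cocycleD(3)[OF D] x by simp_all
    have "ns2_br_basis (II 0) x = 0" using x by (cases x) simp_all
    then have "act (II 0) (D (bvec x)) = 0"
      using skew_cocycleD(4)[OF D, of "II 0" x] x by (simp add: I0 skew_cocycle_linear[OF D] adj_act_simps)
    then have "act (II 0) (D (bvec x)) \<bullet> (GP a, GP b) = 0" for a b by simp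
    then have "D (bvec x) \<bullet> (GP a, GP b) = 0" for a b by (simp add: lookup_adj_act coord_br_I0)
    with even_structure[OF ev skew act_GP_even_central[OF D P x]] show ?thesis
      unfolding central_def by metis
  qed
  have "central (D (bvec (GM b)))" for b
  proof (rule odd_rigid[OF odd_D(2)[OF D] skew_cocycleD(3)[OF D]])
    fix k
    have "central (D (ns2_br_basis (GP k) (GM b)))"
      by (simp add: ns2_GG_def skew_cocycle_linear[OF D] central_closed even)
    moreover have "act (GP k) (D (bvec (GM b)))
        = D (ns2_br_basis (GP k) (GM b)) - act (GM b) (D (bvec (GP k)))"
      using skew_cocycleD(4)[OF D, of "GP k" "GM b"] by simp
    ultimately show "central (act (GP k) (D (bvec (GM b))))"
      by (simp add: central_closed central_act P)
  qed
  then show ?thesis using even P by (cases x) simp_all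
qed

text \<open>
  A cocycle with central values is a derivation into the algebra modulo its centre.  Its value on an even
  element is determined by the action of \<open>GP 0\<close> and \<open>GP (- 1)\<close> on this value.
  This disposes first of $I_0$, $L_0$, $L_{\pm1}$, then of $I_{\pm1}$,
  which move any \<open>GP t\<close> to any other, and finally of everything else.
\<close>

lemma zero_if_all_central:
  assumes D: "skew_cocycle D" and C: "\<And>x. central (D (bvec x))"
    and G0: "D (bvec (GP 0)) = 0" "D (bvec (GP (- 1))) = 0"
  shows "D (bvec x) = 0"
proof -
  note lin = skew_cocycle_linear[OF D]
  have skew: "ns2_skew (D (bvec x))" for x by (rule skew_cocycleD(3)[OF D])
  have even_zero: "D (bvec x) = 0"
    if x: "ns2_par x = 0" "act (GP 0) (D (bvec x)) = 0" "act (GP (- 1)) (D (bvec x)) = 0" for x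
    using skew_cocycleD(2)[OF D, of x] x
    by (intro central_skew_zero[OF C skew] even_CC_row_zero[OF _ skew]) simp_all
  have cocycle_even: "act (GP k) (D (bvec x)) = D (ns2_br_basis (GP k) x) + act x (D (bvec (GP k)))"
    if "ns2_par x = 0" for k x
    using skew_cocycleD(4)[OF D, of "GP k" x] that by simp
  have LL: "D (bvec (LL m)) = 0" if "m \<in> {-1, 0, 1}" for m
    by (rule even_zero)
      (use that in \<open>auto simp: cocycle_even lin G0 adj_act_simps half_mode_def\<close>)
  have I0: "D (bvec (II 0)) = 0"
    by (rule even_zero) (simp_all add: cocycle_even lin G0 adj_act_simps)
  have I: "D (bvec (II m)) = 0" if m: "m \<in> {-1, 1}" for m
  proof (rule central_skew_zero[OF C skew])
    define e where "e = row CC (D (bvec (II m)))"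
    have "act (LL (- m)) (D (bvec (II m))) = 0"
      using skew_cocycleD(4)[OF D, of "LL (- m)" "II m"] LL[of "- m"] m
      by (auto simp: lin I0 adj_act_simps)
    then have 1: "ns2_br (bvec (LL (- m))) e \<bullet> q = 0" if "q \<noteq> CC" for q
      using coord_act_central[OF C that, of "LL (- m)" "II m"] by (simp add: e_def)
    have "act (LL 0) (D (bvec (II m))) = (- of_int m) \<cdot> D (bvec (II m))"
      using skew_cocycleD(4)[OF D, of "LL 0" "II m"] LL[of 0]
      by (simp add: lin adj_act_simps)
    then have 2: "ns2_br (bvec (LL 0)) e \<bullet> q = - of_int m * (e \<bullet> q)" if "q \<noteq> CC" for q
      using coord_act_central[OF C that, of "LL 0" "II m"] by (simp add: e_def)
    \<comment> \<open>$L_0$ confines \<open>e\<close> to the mode \<open>m\<close>, where \<open>L\<^sub>-\<^sub>m\<close> is injective\<close>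
    have LLn: "e \<bullet> LL n = 0" for n
      using 1[of "LL (n - m)"] 2[of "LL n"] m by (auto simp: coord_br_LL)
    have IIn: "e \<bullet> II n = 0" for n
      using 1[of "II (n - m)"] 2[of "II n"] m by (auto simp: coord_br_LL)
    have even: "even_tensor (D (bvec (II m)))"
      using skew_cocycleD(2)[OF D, of "II m"] by simp
    show "D (bvec (II m)) \<bullet> (CC, q) = 0" for q
      using LLn IIn
      by (cases q) (simp_all add: e_def even_coord[OF even] skew_coord_CC[OF skew])
  qed
  have step: "D (bvec (GP (m + t))) = 0" if "m \<in> {-1, 1}" "D (bvec (GP t)) = 0" for m t
    using skew_cocycleD(4)[OF D, of "II m" "GP t"] that I[of m] by (simp add: adj_act_simps)
  have GP: "D (bvec (GP t)) = 0" for t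
  proof (induction t rule: int_induct[where k = 0])
    case base
    show ?case by (rule G0)
  next
    case (step1 i)
    then show ?case using step[of 1 i] by (simp add: add.commute)
  next
    case (step2 i)
    then show ?case using step[of "-1" i] by simp
  qed
  have even: "D (bvec x) = 0" if x: "ns2_par x = 0" for x
  proof (rule even_zero[OF x])
    have "D (ns2_br_basis (GP k) x) = 0" for k
      using x by (cases x) (simp_all add: lin GP)
    then show "act (GP 0) (D (bvec x)) = 0" "act (GP (- 1)) (D (bvec x)) = 0"
      using x by (simp_all add: cocycle_even GP adj_act_simps)
  qed
  have "D (bvec (GM b)) = 0" for b
  proof (rule central_skew_zero[OF C skew])
    define v where "v = D (bvec (GM b))"
    have odd: "odd_tensor v" unfolding v_def by (rule odd_D[OF D])
    have "act (GP 0) v = 0"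
      using skew_cocycleD(4)[OF D, of "GP 0" "GM b"]
      by (simp add: v_def ns2_GG_def lin even GP adj_act_simps)
    then have "act (GP 0) v \<bullet> (CC, LL (n + 1)) = 0" for n by simp
    then have GM: "v \<bullet> (CC, GM n) = 0" for n by (simp add: lookup_adj_act coord_br_GP)
    have "act (II 0) v = - v"
      using skew_cocycleD(4)[OF D, of "II 0" "GM b"]
      by (simp add: v_def lin I0 adj_act_simps)
    then have "act (II 0) v \<bullet> (CC, GP n) = (- v) \<bullet> (CC, GP n)" for n by simp
    then have GPn: "v \<bullet> (CC, GP n) = 0" for n by (simp add: lookup_adj_act coord_br_I0)
    show "D (bvec (GM b)) \<bullet> (CC, q) = 0" for q
      unfolding v_def[symmetric] by (cases q) (simp_all add: GM GPn odd_coord[OF odd])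
  qed
  then show ?thesis using even GP by (cases x) simp_all
qed

text \<open>
  The potentials of the preceding steps add up.  Each one is chosen so that it does not disturb the
  values that have been normalised before.
\<close>

theorem skew_cocycle_inner:
  assumes D: "skew_cocycle D"
  shows "\<exists>r. even_skew r \<and> (\<forall>x. D x = adj_act ns2_par ns2_br x r)"
proof -
  obtain r1 where r1: "even_skew r1" "D (bvec (GP 0)) = act (GP 0) r1"
      "D (bvec (GP (- 1))) = act (GP (- 1)) r1"
    by (rule potential_GP_half[OF D])
  define D1 where "D1 = (\<lambda>x. D x - adj_act ns2_par ns2_br x r1)"
  have D1: "skew_cocycle D1" "D1 (bvec (GP 0)) = 0" "D1 (bvec (GP (- 1))) = 0"
    unfolding D1_def by (intro skew_cocycle_diff[OF D r1(1)]) (simp_all add: r1)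
  obtain r2 where r2: "even_skew r2" "act (GP 0) r2 = 0" "act (GP (- 1)) r2 = 0"
      "central (D1 (bvec (GP 1)) - act (GP 1) r2)"
    by (rule potential_GP_three_halves[OF D1])
  define D2 where "D2 = (\<lambda>x. D1 x - adj_act ns2_par ns2_br x r2)"
  have D2: "skew_cocycle D2" "D2 (bvec (GP 0)) = 0" "D2 (bvec (GP (- 1))) = 0"
      "central (D2 (bvec (GP 1)))"
    unfolding D2_def by (intro skew_cocycle_diff[OF D1(1) r2(1)]) (simp_all add: r2 D1)
  have P2: "central (D2 (bvec (GP t)))" for t
    by (rule odd_generators_central[OF D2])
  obtain r3 where r3: "even_skew r3" "\<And>t. act (GP t) r3 = 0" "act (II 0) r3 = D2 (bvec (II 0))"
    using potential_I0[OF D2(1-3) P2] by blast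
  define D3 where "D3 = (\<lambda>x. D2 x - adj_act ns2_par ns2_br x r3)"
  have D3: "skew_cocycle D3" "D3 (bvec (GP 0)) = 0" "D3 (bvec (GP (- 1))) = 0"
      "D3 (bvec (II 0)) = 0" "\<And>t. central (D3 (bvec (GP t)))"
    unfolding D3_def by (intro skew_cocycle_diff[OF D2(1) r3(1)]) (simp_all add: r3 D2 P2)
  have zero: "D3 (bvec x) = 0" for x
    by (rule zero_if_all_central[OF D3(1) all_central[OF D3(1,5,4)] D3(2,3)])
  have "D3 x = 0" for x
    by (rule clinear_eqI[OF skew_cocycleD(1)[OF D3(1)] clinearI]) (simp_all add: zero)
  then have "D x = adj_act ns2_par ns2_br x (r1 + r2 + r3)" for x
    by (simp add: D3_def D2_def D1_def adj_act_simps algebra_simps)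
  moreover have "even_skew (r1 + r2 + r3)"
    using r1(1) r2(1) r3(1) by (simp add: even_skew_def homog_closed skew_closed)
  ultimately show ?thesis by blast
qed

end

section \<open>Invariants of the triple tensor power\<close>

lemma coord_super_cyclic_CC: "super_cyclic ns2_par z \<bullet> (CC, CC, CC) = z \<bullet> (CC, CC, CC)"
  unfolding super_cyclic_def
  by (subst lookup_lin_ext[of "{(CC, CC, CC)}"]) (auto simp: single_simps split: if_splits)

context lie_superalgebra
begin

lemma coboundary_even:
  assumes "r \<in> homog (tensor_par par) 0"
  shows "coboundary par br r x = adj_act par br x r"
  using assms
proof (induction r rule: homog_induct)
  case (basis c u)
  obtain a b where u: "u = (a, b)" by (cases u)
  have "coboundary par br (bvec (a, b)) x = adj_act par br x (bvec (a, b))"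
    using basis
    by (induction x rule: cvec_induct)
      (simp_all del: add_bit_eq_xor add: coboundary_def u adj_act_simps multilinear)
  then show ?case by (simp add: u coboundary_def adj_act_simps multilinear)
qed (simp_all add: coboundary_def adj_act_simps multilinear)

end

context ns2_algebra
begin

text \<open>
  The action of a mode $k$ on the other legs keeps the first leg fixed.  Looking at a first leg
  beyond the support of $z$, only the action on the first leg is seen there; it brings any
  given noncentral vector into such a position when $k$ is large.
\<close>

lemma first_leg_central:
  assumes inv: "\<And>x. slots (\<lambda>a. ns2_br (bvec x) (bvec a)) (B x) z = 0" and "p \<noteq> CC"
  shows "z \<bullet> (p, m) = 0"
proof -
  obtain N where "\<And>pm. \<bar>mode (fst pm)\<bar> > N \<Longrightarrow> z \<bullet> pm = 0"
    using support_bound[of "\<lambda>pm. \<bar>mode (fst pm)\<bar>" z] by blast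
  then have N: "row p z = 0" if "\<bar>mode p\<bar> > N" for p
    using that by (intro poly_mapping_eqI) simp
  have far: "ns2_br (bvec x) (col m z) \<bullet> p = 0" if "\<bar>mode p\<bar> > N" for x p m
    using inv[of x] lookup_slots[of "\<lambda>a. ns2_br (bvec x) (bvec a)" "B x" z p m]
    by (simp add: N[OF that] br_lin_ext)
  have LI: "z \<bullet> (LL c, m) = 0 \<and> z \<bullet> (II c, m) = 0" for c
  proof -
    \<comment> \<open>for $l \ge k$ the position \<open>c + l\<close> lies outside the support\<close>
    define k where "k = \<bar>N\<bar> + \<bar>c\<bar> + 1"
    have *: "(2 * of_int l + 1 - of_int c) / 2 * (z \<bullet> (LL c, m)) - z \<bullet> (II c, m) = 0"
      if "l \<ge> k" for l
    proof -
      have "\<bar>mode (GP (c + l))\<bar> > N" using that by (simp add: k_def)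
      from far[OF this, of "GP l" m] show ?thesis by (simp add: coord_br_GP field_simps)
    qed
    have "z \<bullet> (LL c, m)
      = ((2 * of_int (k + 1) + 1 - of_int c) / 2 * (z \<bullet> (LL c, m)) - z \<bullet> (II c, m))
        - ((2 * of_int k + 1 - of_int c) / 2 * (z \<bullet> (LL c, m)) - z \<bullet> (II c, m))"
      by (simp add: field_simps)
    also have "\<dots> = 0" using *[of k] *[of "k + 1"] by simp
    finally show ?thesis using *[of k] by simp
  qed
  have G: "z \<bullet> (GM j, m) = 0 \<and> z \<bullet> (GP j, m) = 0" for j
  proof -
    define k where "k = \<bar>N\<bar> + \<bar>j\<bar> + 1"
    have "\<bar>mode (LL (j + k + 1))\<bar> > N" by (simp add: k_def)
    from far[OF this, of "GP k" m] far[OF this, of "GM k" m] show ?thesis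
      by (simp add: coord_br_GP coord_br_GM)
  qed
  show ?thesis using \<open>p \<noteq> CC\<close> LI G by (cases p) auto
qed

lemma coord_slots_CC:
  assumes "\<And>p m. p \<noteq> CC \<Longrightarrow> z \<bullet> (p, m) = 0"
  shows "slots (\<lambda>a. ns2_br (bvec x) (bvec a)) B z \<bullet> (CC, m) = lin_ext (B CC) (row CC z) \<bullet> m"
proof -
  have "ns2_br (bvec x) (col m z) = 0"
    by (rule ns2_br_central_vector) (simp add: assms)
  then show ?thesis by (simp add: lookup_slots br_lin_ext)
qed

text \<open>
  The invariants of the cube are the multiples of $C \otimes C \otimes C$: the first leg is central, hence the
  other two form an invariant of the square, and so on.
\<close>

lemma triple_invariant:
  assumes inv: "\<And>x. triple_act ns2_par ns2_br x z = 0" and CCC: "z \<bullet> (CC, CC, CC) = 0"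
  shows "z = 0"
proof -
  have 1: "z \<bullet> (p, m) = 0" if "p \<noteq> CC" for p m
    by (rule first_leg_central[OF inv[unfolded triple_act_def] that])
  define y where "y = row CC z"
  have "act x y \<bullet> m = 0" for x m
    using coord_slots_CC[OF 1, of x "\<lambda>a m. ksign (ns2_par x * ns2_par a) \<cdot> act x (bvec m)" m]
      inv[of x]
    by (simp add: triple_act_def y_def lin_ext_smul_fun adj_act_lin_ext)
  then have inv_y: "act x y = 0" for x by (intro poly_mapping_eqI) simp
  have 2: "y \<bullet> (p, q) = 0" if "p \<noteq> CC" for p q
    by (rule first_leg_central[OF inv_y[unfolded adj_act_bvec] that])
  define w where "w = row CC y"
  have inv_w: "ns2_br (bvec x) w \<bullet> q = 0" for x q
    using coord_slots_CC[OF 2, of x "\<lambda>a b. ksign (ns2_par x * ns2_par a) \<cdot> ns2_br (bvec x) (bvec b)" q]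
      inv_y[of x]
    by (simp add: adj_act_bvec w_def lin_ext_smul_fun br_lin_ext)
  have LI: "w \<bullet> LL c = 0 \<and> w \<bullet> II c = 0" for c
    using inv_w[of "GP 0" "GP c"] inv_w[of "GP (- 1)" "GP (c - 1)"]
    by (simp add: coord_br_GP field_simps)
  have G: "w \<bullet> GM j = 0 \<and> w \<bullet> GP j = 0" for j
    using inv_w[of "GP 0" "LL (j + 1)"] inv_w[of "GM 0" "LL (j + 1)"]
    by (simp add: coord_br_GP coord_br_GM)
  have 3: "w \<bullet> q = 0" for q
    using LI G CCC by (cases q) (simp_all add: w_def y_def)
  show ?thesis
  proof (rule poly_mapping_eqI)
    fix pqs :: "ns2_basis \<times> ns2_basis \<times> ns2_basis"
    obtain p q s where pqs: "pqs = (p, q, s)" by (cases pqs)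
    show "z \<bullet> pqs = 0 \<bullet> pqs"
      using 1[of p "(q, s)"] 2[of q s] 3[of s]
      by (cases "p = CC"; cases "q = CC") (simp_all add: pqs y_def w_def)
  qed
qed

text \<open>
  The coefficient of $C \otimes C \otimes C$ in $[r^{12}, r^{13}]$ is the central component of $[X, X]$, where $X$ is
  the even vector paired with $C$ in $r$; it is zero by skew-symmetry.  The other two leg brackets have the
  same coefficient, being cyclic rotations of this one.
\<close>

lemma coord_cybe_CC:
  assumes "even_skew r"
  shows "cybe ns2_par ns2_br r \<bullet> (CC, CC, CC) = 0"
proof -
  have r: "even_tensor r" "super_twist ns2_par r = - r"
    using assms by (simp_all add: even_skew_def skew_def)
  have T1: "r12_r13 ns2_par ns2_br u v \<bullet> (CC, CC, CC) = ns2_br (col CC u) (col CC v) \<bullet> CC" for u v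
  proof (induction u rule: cvec_induct)
    case (basis c u)
    obtain a b where u: "u = (a, b)" by (cases u)
    show ?case
    proof (induction v rule: cvec_induct)
      case (basis d v)
      obtain a' b' where v: "v = (a', b')" by (cases v)
      show ?case
        by (auto simp: u v leg_bracket_defs col_def multilinear br_simps single_simps)
    qed (simp_all add: leg_bracket_simps col_def lin_ext_add br_simps lookup_add)
  qed (simp_all add: leg_bracket_simps col_def lin_ext_add br_simps lookup_add)
  have "col CC r \<in> homog ns2_par 0"
    unfolding homog_iff_lookup
  proof (intro allI impI, rule ccontr)
    fix a assume "col CC r \<bullet> a \<noteq> 0" "ns2_par a \<noteq> 0"
    then show False using even_coord[OF r(1), of a CC] by simp
  qed
  from super_skew[OF this this] have "ns2_br (col CC r) (col CC r) = 0"
    by (intro eq_uminus_self) simp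
  then have 1: "r12_r13 ns2_par ns2_br r r \<bullet> (CC, CC, CC) = 0" by (simp add: T1)
  note cyc = super_cyclic_leg_bracket[OF r(1) r(1)]
  have 3: "r13_r23 ns2_par ns2_br r r \<bullet> (CC, CC, CC) = 0"
    \<comment> \<open>skewness of \<open>r\<close> removes the twists\<close>
    using coord_super_cyclic_CC[of "r12_r13 ns2_par ns2_br r r"] cyc 1
    by (simp add: r leg_bracket_uminus)
  have 2: "r12_r23 ns2_br r r \<bullet> (CC, CC, CC) = 0"
    using coord_super_cyclic_CC[of "r13_r23 ns2_par ns2_br r r"] cyc 3
    by (simp add: r leg_bracket_uminus)
  show ?thesis by (simp add: cybe_split lookup_add 1 2 3)
qed

end

section \<open>Every bialgebra structure is triangular coboundary\<close>

lemma span_graded: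
  "cvec.span (\<Union>j. {x \<otimes> y |x y. x \<in> homog par j \<and> y \<in> homog par (i - j)})
    \<subseteq> homog (tensor_par par) i"
proof (rule cvec.span_minimal)
  show "(\<Union>j. {x \<otimes> y |x y. x \<in> homog par j \<and> y \<in> homog par (i - j)}) \<subseteq> homog (tensor_par par) i"
  proof clarify
    fix j x y assume "x \<in> homog par j" "y \<in> homog par (i - j)"
    then show "x \<otimes> y \<in> homog (tensor_par par) i"
      by (auto simp: homog_iff_lookup simp del: add_bit_eq_xor)
  qed
  show "cvec.subspace (homog (tensor_par par) i)"
    by (rule cvec.subspaceI) (auto intro: homog_closed)
qed

theorem theorem4p4:
  fixes \<Delta> :: "ns2_basis cvec \<Rightarrow> (ns2_basis \<times> ns2_basis) cvec"
  assumes "lie_superbialgebra ns2_par ns2_br \<Delta>"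
  shows "\<exists>r \<in> im_one_minus_twist ns2_par.
    \<Delta> = coboundary ns2_par ns2_br r \<and> cybe ns2_par ns2_br r = 0"
proof -
  interpret lie_superbialgebra ns2_par ns2_br \<Delta> by (rule assms)
  interpret ns2_algebra ..
  have "skew_cocycle \<Delta>"
    unfolding skew_cocycle_def
  proof (intro conjI allI)
    show "clinear \<Delta>" by (rule cobracket_linear)
    fix x y
    show "\<Delta> (bvec x) \<in> homog (tensor_par ns2_par) (ns2_par x)"
      using cobracket_graded[of "ns2_par x"] span_graded[of ns2_par "ns2_par x"]
        imageI[OF basis_homog, of \<Delta> x] by blast
    show "ns2_skew (\<Delta> (bvec x))"
      using cobracket_skew by (auto simp: skew_iff_im_one_minus_twist)
    show "\<Delta> (ns2_br_basis x y)
        = act x (\<Delta> (bvec y)) - ksign (ns2_par x * ns2_par y) \<cdot> act y (\<Delta> (bvec x))"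
      using cocycle[of "bvec x" "ns2_par x" "bvec y" "ns2_par y"] by (simp add: ns2_br_bvec)
  qed
  then obtain r where r: "even_skew r" and \<Delta>: "\<And>x. \<Delta> x = adj_act ns2_par ns2_br x r"
    using skew_cocycle_inner by blast
  have even: "even_tensor r" and skew: "ns2_skew r" using r by (simp_all add: even_skew_def)
  have "triple_act ns2_par ns2_br x (cybe ns2_par ns2_br r) = 0" for x
    by (rule co_jacobi_cybe[OF even skew \<Delta> co_jacobi])
  then have "cybe ns2_par ns2_br r = 0"
    by (rule triple_invariant) (rule coord_cybe_CC[OF r])
  moreover have "\<Delta> = coboundary ns2_par ns2_br r"
    by (rule ext) (simp add: \<Delta> coboundary_even[OF even])
  ultimately show ?thesis using skew by (auto simp: skew_iff_im_one_minus_twist)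
qed

end
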